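(* Let $r,s\ge2$ and let $F:U\to\mathbb P^{r',s',t'}$ be a local sign-preserving map, where $U\subset\mathbb P^{r,s,t}$ is a connected open set containing a null point. If $r=r'$ or $s=s'$, then $F$ is quasi-standard (standard when $t'=0$).
   Context: Let $r,s,t\ge 0$ be integers with $n=r+s+t>0$. $\mathbb C^{r,s,t}$ denotes $\mathbb C^n$ equipped with the (possibly degenerate, indefinite) Hermitian form $\langle z,w\rangle_{r,s,t}=\sum_{j=1}^{r}z_j\bar w_j-\sum_{j=r+1}^{r+s}z_j\bar w_j$, and $\mathbb P^{r,s,t}$ is its projectivization. A point $[z]$ is positive, negative or null according as $\langle z,z\rangle_{r,s,t}>0$, $<0$ or $=0$. A complex linear subspace $H$ (or $\mathbb PH$) is a null space if the form vanishes identically on $H$. A holomorphic map $F:U\to\mathbb P^{r',s',t'}$ on a connected open set $U$ containing a null point is sign-preserving if it maps positive points to positive points and negative points to negative points. $F$ is linear if it extends to a rational map induced by a linear map $\mathbb C^{r+s+t}\to\mathbb C^{r'+s'+t'}$; standard if it is induced by a linear isometry $\mathbb C^{r,s,t}\to\mathbb C^{r',s',t'}$ (a linear map $L$ with $\langle Lu,Lv\rangle_{r',s',t'}=\langle u,v\rangle_{r,s,t}$); null if $F(U)$ is contained in a null space. $F$ is quasi-standard if either $F$ is standard, or there is a decomposition $\mathbb C^{r',s',t'}=A\oplus B$ into nonzero subspaces with $\langle a,b\rangle_{r',s',t'}=0$ for all $a\in A,b\in B$ such that $\pi_A\circ F$ is standard and $\pi_B\circ F$ is null, where $\pi_A:\mathbb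 P^{r',s',t'}\dashrightarrow\mathbb PA$, $\pi_B:\mathbb P^{r',s',t'}\dashrightarrow\mathbb PB$ are induced by the linear projections, and $\mathbb PA,\mathbb PB$ carry the restricted forms. *)

theory Defs
  imports "HOL-Analysis.Analysis"
begin

text \<open>Model of C^{r,s,t}: the space complex^'n with CARD('n) = r+s+t.  The coordinates
 are numbered 0,...,n-1 via a fixed bijection idx; coordinate number k carries the
 coefficient +1 if k < r, -1 if r \<le> k < r+s, and 0 otherwise.\<close>

definition idx :: "'n::finite \<Rightarrow> nat" where
  "idx = (SOME g. bij_betw g (UNIV::'n set) {..<CARD('n)})"

definition sgn_coef :: "nat \<Rightarrow> nat \<Rightarrow> nat \<Rightarrow> complex" where
  "sgn_coef r s k = (if k < r then 1 else if k < r + s then -1 else 0)"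

text \<open>The Hermitian form of C^{r,s,t} (t is implicit: t = CARD('n) - r - s).\<close>
definition herm :: "nat \<Rightarrow> nat \<Rightarrow> complex^'n::finite \<Rightarrow> complex^'n \<Rightarrow> complex" where
  "herm r s z w = (\<Sum>j\<in>UNIV. sgn_coef r s (idx j) * z$j * cnj (w$j))"

definition pos_pt :: "nat \<Rightarrow> nat \<Rightarrow> complex^'n::finite \<Rightarrow> bool" where
  "pos_pt r s z \<longleftrightarrow> z \<noteq> 0 \<and> Re (herm r s z z) > 0"

definition neg_pt :: "nat \<Rightarrow> nat \<Rightarrow> complex^'n::finite \<Rightarrow> bool" where
  "neg_pt r s z \<longleftrightarrow> z \<noteq> 0 \<and> Re (herm r s z z) < 0"

definition null_pt :: "nat \<Rightarrow> nat \<Rightarrow> complex^'n::finite \<Rightarrow> bool" where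
  "null_pt r s z \<longleftrightarrow> z \<noteq> 0 \<and> herm r s z z = 0"

definition proj_eq :: "complex^'n::finite \<Rightarrow> complex^'n \<Rightarrow> bool" where
  "proj_eq z w \<longleftrightarrow> z \<noteq> 0 \<and> w \<noteq> 0 \<and> (\<exists>c. c \<noteq> 0 \<and> w = c *s z)"

text \<open>An open set U of the projective space is modelled by its cone
 V = pi^{-1}(U) in complex^'n - {0}, which is open, C^*-invariant, and connected iff U is.\<close>
definition cone_set :: "(complex^'n::finite) set \<Rightarrow> bool" where
  "cone_set V \<longleftrightarrow> 0 \<notin> V \<and> (\<forall>z\<in>V. \<forall>c. c \<noteq> 0 \<longrightarrow> c *s z \<in> V)"

definition cholo_on :: "(complex^'n::finite) set \<Rightarrow> (complex^'n \<Rightarrow> complex^'m::finite) \<Rightarrow> bool" where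
  "cholo_on S g \<longleftrightarrow> (\<forall>z\<in>S. \<exists>g'. (g has_derivative g') (at z) \<and>
       (\<forall>c v. g' (c *s v) = c *s g' v))"

text \<open>A holomorphic map F : U \<rightarrow> P(complex^'m), U = pi(V), is represented by a map f on the
 cone V giving homogeneous coordinates: f is nonvanishing, F([z]) = [f z] is well defined,
 and F is holomorphic, i.e. locally it admits holomorphic lifts.\<close>
definition proj_holo_map :: "(complex^'n::finite) set \<Rightarrow> (complex^'n \<Rightarrow> complex^'m::finite) \<Rightarrow> bool" where
  "proj_holo_map V f \<longleftrightarrow>
     (\<forall>z\<in>V. f z \<noteq> 0) \<and>
     (\<forall>z\<in>V. \<forall>c. c \<noteq> 0 \<longrightarrow> proj_eq (f z) (f (c *s z))) \<and>
     (\<forall>z\<in>V. \<exists>e>0. \<exists>g. ball z e \<subseteq> V \<and> cholo_on (ball z e) g \<and>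
                 (\<forall>w\<in>ball z e. proj_eq (f w) (g w)))"

definition sign_preserving ::
  "nat \<Rightarrow> nat \<Rightarrow> nat \<Rightarrow> nat \<Rightarrow> (complex^'n::finite) set \<Rightarrow> (complex^'n \<Rightarrow> complex^'m::finite) \<Rightarrow> bool" where
  "sign_preserving r s r' s' V f \<longleftrightarrow>
     (\<forall>z\<in>V. pos_pt r s z \<longrightarrow> pos_pt r' s' (f z)) \<and>
     (\<forall>z\<in>V. neg_pt r s z \<longrightarrow> neg_pt r' s' (f z))"

definition csubspace :: "(complex^'m::finite) set \<Rightarrow> bool" where
  "csubspace A \<longleftrightarrow> 0 \<in> A \<and> (\<forall>x\<in>A. \<forall>y\<in>A. x + y \<in> A) \<and> (\<forall>c. \<forall>x\<in>A. c *s x \<in> A)"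

text \<open>A (rational) map into a projectivization, given on V by homogeneous coordinates g
 (defined where g is nonzero), is induced by the linear map L: where both are defined
 they agree, and they are both defined somewhere (hence on a dense open subset).\<close>
definition induced_by :: "(complex^'n::finite) set \<Rightarrow> (complex^'n \<Rightarrow> complex^'m::finite) \<Rightarrow>
     (complex^'n \<Rightarrow> complex^'m) \<Rightarrow> bool" where
  "induced_by V g L \<longleftrightarrow> (\<exists>z\<in>V. L z \<noteq> 0 \<and> g z \<noteq> 0) \<and>
      (\<forall>z\<in>V. L z \<noteq> 0 \<and> g z \<noteq> 0 \<longrightarrow> proj_eq (g z) (L z))"

definition lin_isometry :: "nat \<Rightarrow> nat \<Rightarrow> nat \<Rightarrow> nat \<Rightarrow> complex^'n::finite^'m::finite \<Rightarrow> bool" where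
  "lin_isometry r s r' s' M \<longleftrightarrow> (\<forall>u v. herm r' s' (M *v u) (M *v v) = herm r s u v)"

definition standard_map ::
  "nat \<Rightarrow> nat \<Rightarrow> nat \<Rightarrow> nat \<Rightarrow> (complex^'n::finite) set \<Rightarrow> (complex^'n \<Rightarrow> complex^'m::finite) \<Rightarrow> bool" where
  "standard_map r s r' s' V f \<longleftrightarrow>
     (\<exists>M::complex^'n^'m. lin_isometry r s r' s' M \<and> induced_by V f (\<lambda>z. M *v z))"

definition proj_along :: "(complex^'m::finite) set \<Rightarrow> (complex^'m) set \<Rightarrow> complex^'m \<Rightarrow> complex^'m" where
  "proj_along A B x = (THE a. a \<in> A \<and> x - a \<in> B)"

definition quasi_standard ::
  "nat \<Rightarrow> nat \<Rightarrow> nat \<Rightarrow> nat \<Rightarrow> (complex^'n::finite) set \<Rightarrow> (complex^'n \<Rightarrow> complex^'m::finite) \<Rightarrow> bool" where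
  "quasi_standard r s r' s' V f \<longleftrightarrow>
     standard_map r s r' s' V f \<or>
     (\<exists>A B. csubspace A \<and> csubspace B \<and> A \<noteq> {0} \<and> B \<noteq> {0} \<and>
        A \<inter> B = {0} \<and> (\<forall>x. \<exists>a\<in>A. \<exists>b\<in>B. x = a + b) \<and>
        (\<forall>a\<in>A. \<forall>b\<in>B. herm r' s' a b = 0) \<and>
        \<comment> \<open>pi_A o F is standard: induced by a linear isometry into A (with the restricted form)\<close>
        (\<exists>M::complex^'n^'m. lin_isometry r s r' s' M \<and> (\<forall>u. M *v u \<in> A) \<and>
            induced_by V (\<lambda>z. proj_along A B (f z)) (\<lambda>z. M *v z)) \<and>
        \<comment> \<open>pi_B o F is null: its image (where defined) lies in a null subspace of B\<close>
        (\<exists>H. csubspace H \<and> H \<subseteq> B \<and> (\<forall>x\<in>H. \<forall>y\<in>H. herm r' s' x y = 0) \<and>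
            (\<forall>z\<in>V. proj_along B A (f z) \<noteq> 0 \<longrightarrow> proj_along B A (f z) \<in> H)))"

end

theory Submission
  imports Defs "HOL-Complex_Analysis.Conformal_Mappings"
begin

text \<open>Say \<open>r = r'\<close>; the case \<open>s = s'\<close> follows by negating both forms. Discarding the null coordinates
  of a local lift gives a holomorphic map \<open>g\<close> near a null point. By polarisation, \<open>g\<close> preserves
  orthogonality. Since an orthogonal family in the target contains at most \<open>r\<close> positive vectors,
  points of a null line of the source have collinear images: the line can be completed by
  \<open>r - 2\<close> orthogonal positive points. Null lines form a uniqueness set among the
  lines near them, so all these lines have collinear images. It follows that
  \<open>\<langle>g x, g w\<rangle> = \<phi>(x) \<psi>(w) \<langle>x, w\<rangle>\<close> for \<open>x\<close> and \<open>w\<close> in suitable open sets, hence \<open>g\<close> is a multiple of a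
  linear map \<open>M\<close> there, and \<open>M\<close> is an isometry up to a positive factor. The identity theorem
  propagates \<open>g \<parallel> M\<close>. The decomposition of the target is the one into
  nonnull and null coordinates.\<close>

subsection \<open>Hermitian forms\<close>

text \<open>When \<open>r = r'\<close>, nothing bounds the negative index of the target, so only the
  positive index can be used. It acts as follows: among more than \<open>r'\<close> mutually
  orthogonal vectors of nonnegative square, some nontrivial combination has no positive coordinates.
  Its square is then both at most 0 and at least 0, so once null coordinates are removed the
  combination is zero and involves no vector of positive square. If the family is filled up with
  images of positive points, a dependence among the null images remains. The second obstacle is
  degeneracy: a null line might a priori be contracted to a point. This is excluded by finding a
  null \<open>x\<close>, an isotropic direction \<open>u\<close> and a \<open>w\<close> orthogonal
  to \<open>x\<close> such that \<open>\<langle>g x, g w\<rangle>\<close> has a simple zero along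
  \<open>u\<close>. Differentiating the collinearity relation at such a zero brings in the factor
  \<open>\<langle>x, w\<rangle>\<close>. The forms carry weights \<open>c\<close> instead of
  \<open>r\<close> and \<open>s\<close>, so that negating a form means passing to \<open>-c\<close>.
  Holomorphy is used only along curves and complex lines, where the one-variable identity theorem
  applies.\<close>

definition hf :: "('n::finite \<Rightarrow> real) \<Rightarrow> complex^'n \<Rightarrow> complex^'n \<Rightarrow> complex" where
  "hf c z w = (\<Sum>j\<in>UNIV. of_real (c j) * z$j * cnj (w$j))"

text \<open>The Gram matrix applied to \<open>z\<close>. The pairing of \<open>z\<close> with
  \<open>hflip c z\<close> is a sum of squares that vanishes only on the radical, which makes
  \<open>hflip c z\<close> the direction in which a null \<open>z\<close> outside the radical is
  moved to positive and negative points.\<close>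

definition hflip :: "('n::finite \<Rightarrow> real) \<Rightarrow> complex^'n \<Rightarrow> complex^'n" where
  "hflip c z = (\<chi> j. of_real (c j) * z$j)"

lemma hf_add_left: "hf c (x + y) w = hf c x w + hf c y w"
  by (simp add: hf_def algebra_simps sum.distrib)

lemma hf_add_right: "hf c w (x + y) = hf c w x + hf c w y"
  by (simp add: hf_def algebra_simps sum.distrib)

lemma hf_diff_left: "hf c (x - y) w = hf c x w - hf c y w"
  by (simp add: hf_def algebra_simps sum_subtractf)

lemma hf_diff_right: "hf c w (x - y) = hf c w x - hf c w y"
  by (simp add: hf_def algebra_simps sum_subtractf)

lemma hf_scale_left: "hf c (a *s x) w = a * hf c x w"
  by (simp add: hf_def algebra_simps sum_distrib_left)

lemma hf_scale_right: "hf c x (a *s w) = cnj a * hf c x w"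
  by (simp add: hf_def algebra_simps sum_distrib_left)

lemma hf_zero_left [simp]: "hf c 0 w = 0"
  by (simp add: hf_def)

lemma hf_zero_right [simp]: "hf c w 0 = 0"
  by (simp add: hf_def)

lemmas hf_lin = hf_add_left hf_add_right hf_diff_left hf_diff_right hf_scale_left hf_scale_right

lemma hf_sum_left: "hf c (\<Sum>i\<in>I. f i) w = (\<Sum>i\<in>I. hf c (f i) w)"
  by (induction I rule: infinite_finite_induct) (auto simp: hf_add_left)

lemma hf_sum_right: "hf c w (\<Sum>i\<in>I. f i) = (\<Sum>i\<in>I. hf c w (f i))"
  by (induction I rule: infinite_finite_induct) (auto simp: hf_add_right)

lemma hf_cnj: "cnj (hf c z w) = hf c w z"
  by (simp add: hf_def algebra_simps)

lemma hf_sym_0: "hf c z w = 0 \<longleftrightarrow> hf c w z = 0"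
  by (metis hf_cnj complex_cnj_zero)

lemma hf_self_Im [simp]: "Im (hf c z z) = 0"
  by (metis hf_cnj complex_cnj_cancel_iff cnj.sel(2) equal_neg_zero)

lemma hf_self_Re: "hf c z z = of_real (Re (hf c z z))"
  by (simp add: complex_eq_iff)

lemma hf_self_sum: "Re (hf c z z) = (\<Sum>j\<in>UNIV. c j * (cmod (z$j))\<^sup>2)"
  unfolding hf_def Re_sum
  by (rule sum.cong) (auto simp: cmod_power2 power2_eq_square[of "Re _"] power2_eq_square[of "Im _"] algebra_simps)

lemma hf_uminus: "hf (\<lambda>j. - c j) z w = - hf c z w"
  by (simp add: hf_def sum_negf)

lemma tendsto_hf [tendsto_intros]:
  assumes "(f \<longlongrightarrow> a) F" "(g \<longlongrightarrow> b) F"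
  shows "((\<lambda>x. hf c (f x) (g x)) \<longlongrightarrow> hf c a b) F"
  unfolding hf_def by (intro tendsto_intros assms)

lemma continuous_on_hf [continuous_intros]:
  assumes "continuous_on S f" "continuous_on S g"
  shows "continuous_on S (\<lambda>x. hf c (f x) (g x))"
  unfolding hf_def by (intro continuous_intros assms)

lemma tendsto_vec_scale [tendsto_intros]:
  fixes g :: "'a \<Rightarrow> complex^'n"
  assumes "(f \<longlongrightarrow> a) F" "(g \<longlongrightarrow> b) F"
  shows "((\<lambda>x. f x *s g x) \<longlongrightarrow> a *s b) F"
  unfolding vector_scalar_mult_def by (intro tendsto_intros assms)

lemma continuous_on_vec_scale [continuous_intros]:
  fixes g :: "'a::topological_space \<Rightarrow> complex^'n"
  assumes "continuous_on S f" "continuous_on S g"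
  shows "continuous_on S (\<lambda>x. f x *s g x)"
  unfolding vector_scalar_mult_def by (intro continuous_intros assms)

lemma hf_hflip_self: "hf c x (hflip c x) = of_real (\<Sum>j\<in>UNIV. (c j * cmod (x$j))\<^sup>2)"
  unfolding hf_def hflip_def of_real_sum
proof (rule sum.cong)
  fix j show "complex_of_real (c j) * x $ j * cnj ((\<chi> j. complex_of_real (c j) * x $ j) $ j) = complex_of_real ((c j * cmod (x $ j))\<^sup>2)"
    using complex_norm_square[of "x $ j"] by (simp add: power_mult_distrib) (simp add: power2_eq_square algebra_simps)
qed simp

lemma hf_hflip_hflip:
  assumes "\<And>j. c j \<in> {-1, 0, 1}"
  shows "hf c (hflip c x) (hflip c y) = hf c x y"
  unfolding hf_def hflip_def
proof (rule sum.cong)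
  fix j show "complex_of_real (c j) * (\<chi> j. complex_of_real (c j) * x $ j) $ j * cnj ((\<chi> j. complex_of_real (c j) * y $ j) $ j)
     = complex_of_real (c j) * x $ j * cnj (y $ j)"
    using assms[of j] by auto
qed simp

lemma hflip_commute: "hf c (hflip c x) y = hf c x (hflip c y)"
  unfolding hf_def hflip_def by (simp add: algebra_simps)

section \<open>Orthogonal families and dimension counts\<close>

lemma exists_kernel_vector:
  fixes A :: "'j \<Rightarrow> 'i \<Rightarrow> complex"
  assumes "finite J" "finite I" "card J < card I"
  shows "\<exists>x. (\<exists>i\<in>I. x i \<noteq> 0) \<and> (\<forall>i. i \<notin> I \<longrightarrow> x i = 0) \<and> (\<forall>j\<in>J. (\<Sum>i\<in>I. A j i * x i) = 0)"
  using assms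
proof (induction J arbitrary: I A rule: finite_induct)
  case empty
  then obtain i where "i \<in> I" by fastforce
  then show ?case by (intro exI[of _ "\<lambda>k. if k = i then 1 else 0"]) auto
next
  case (insert j0 J)
  show ?case
  proof (cases "\<forall>i\<in>I. A j0 i = 0")
    case True
    have "card J < card I" using insert by auto
    from insert.IH[OF \<open>finite I\<close> this, of A] obtain x
      where x: "\<exists>i\<in>I. x i \<noteq> 0" "\<forall>i. i \<notin> I \<longrightarrow> x i = 0" "\<forall>j\<in>J. (\<Sum>i\<in>I. A j i * x i) = 0"
      by blast
    have "(\<Sum>i\<in>I. A j0 i * x i) = 0" using True by (intro sum.neutral) simp
    then show ?thesis using x by blast
  next
    case False
    \<comment> \<open>Gaussian elimination: \<open>A j0 i0\<close> is the pivot that removes the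
      unknown \<open>i0\<close> from the remaining equations, so that one equation and one unknown
      fewer are left.\<close>
    then obtain i0 where i0: "i0 \<in> I" "A j0 i0 \<noteq> 0" by auto
    define I' where "I' = I - {i0}"
    have fI: "finite I'" and cI: "card J < card I'" and I: "I = insert i0 I'" "i0 \<notin> I'"
      using insert i0 unfolding I'_def by (auto simp: card_Diff_singleton)
    obtain x where x: "\<exists>i\<in>I'. x i \<noteq> 0" "\<forall>i. i \<notin> I' \<longrightarrow> x i = 0"
      "\<forall>j\<in>J. (\<Sum>i\<in>I'. (A j i - A j i0 * A j0 i / A j0 i0) * x i) = 0"
      using insert.IH[OF fI cI, of "\<lambda>j i. A j i - A j i0 * A j0 i / A j0 i0"] by blast
    \<comment> \<open>The value of the eliminated unknown that the pivot equation forces.\<close>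
    define b where "b = - (\<Sum>i\<in>I'. A j0 i * x i) / A j0 i0"
    have s: "(\<Sum>i\<in>I. A j i * (x(i0 := b)) i) = A j i0 * b + (\<Sum>i\<in>I'. A j i * x i)" for j
    proof -
      have "(\<Sum>i\<in>I'. A j i * (x(i0 := b)) i) = (\<Sum>i\<in>I'. A j i * x i)"
        using I by (intro sum.cong) auto
      then show ?thesis using I fI by simp
    qed
    have "(\<Sum>i\<in>I. A j i * (x(i0 := b)) i) = 0" if "j \<in> J" for j
    proof -
      have "0 = (\<Sum>i\<in>I'. (A j i - A j i0 * A j0 i / A j0 i0) * x i)" using x that by simp
      also have "\<dots> = (\<Sum>i\<in>I'. A j i * x i) - A j i0 / A j0 i0 * (\<Sum>i\<in>I'. A j0 i * x i)"
        by (simp add: sum_distrib_left algebra_simps sum_subtractf)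
      also have "\<dots> = (\<Sum>i\<in>I. A j i * (x(i0 := b)) i)"
        unfolding s unfolding b_def by simp
      finally show ?thesis by simp
    qed
    moreover have "(\<Sum>i\<in>I. A j0 i * (x(i0 := b)) i) = 0"
      unfolding s unfolding b_def using i0 by simp
    moreover have "\<exists>i\<in>I. (x(i0 := b)) i \<noteq> 0" "\<forall>i. i \<notin> I \<longrightarrow> (x(i0 := b)) i = 0" using x I by auto
    ultimately show ?thesis by blast
  qed
qed

text \<open>With constant weight on \<open>P\<close>, orthogonality to \<open>N\<close> amounts to
  \<open>card N\<close> linear equations in the \<open>card P\<close> coordinates of
  \<open>x\<close>.\<close>

lemma exists_supported_orthogonal:
  fixes c :: "'n::finite \<Rightarrow> real"
  assumes "finite N" "card N < card P" "\<And>j. j \<in> P \<Longrightarrow> c j = a"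
  shows "\<exists>x. x \<noteq> 0 \<and> (\<forall>j. j \<notin> P \<longrightarrow> x$j = 0) \<and> (\<forall>v\<in>N. hf c x v = 0)"
proof -
  obtain x where x: "\<exists>i\<in>P. x i \<noteq> 0" "\<forall>i. i \<notin> P \<longrightarrow> x i = 0"
     "\<forall>v\<in>N. (\<Sum>i\<in>P. cnj (v$i) * x i) = 0"
    using exists_kernel_vector[of N P "\<lambda>v i. cnj (v$i)"] assms by auto
  have "hf c (\<chi> i. x i) v = of_real a * (\<Sum>i\<in>P. cnj (v$i) * x i)" for v
  proof -
    have "hf c (\<chi> i. x i) v = (\<Sum>i\<in>P. of_real (c i) * x i * cnj (v$i))"
      unfolding hf_def vec_lambda_beta using x by (intro sum.mono_neutral_right) auto
    also have "\<dots> = of_real a * (\<Sum>i\<in>P. cnj (v$i) * x i)"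
      unfolding sum_distrib_left using assms by (intro sum.cong) auto
    finally show ?thesis .
  qed
  then show ?thesis using x by (intro exI[of _ "\<chi> i. x i"]) (auto simp: vec_eq_iff)
qed

lemma hf_supported_pos:
  fixes c :: "'n::finite \<Rightarrow> real"
  assumes "x \<noteq> 0" "\<And>j. c j \<noteq> 1 \<Longrightarrow> x$j = 0"
  shows "Re (hf c x x) > 0"
proof -
  obtain j where j: "x$j \<noteq> 0" using assms(1) by (auto simp: vec_eq_iff)
  show ?thesis unfolding hf_self_sum
  proof (rule sum_pos2[of _ j])
    show "0 < c j * (cmod (x $ j))\<^sup>2" using assms(2)[of j] j by (cases "c j = 1") auto
    show "0 \<le> c i * (cmod (x $ i))\<^sup>2" for i using assms(2)[of i] by (cases "c i = 1") auto
  qed auto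
qed

text \<open>A greedy choice: each new vector is supported on positive coordinates, hence positive,
  and the vectors of \<open>N\<close> together with the earlier choices impose fewer conditions than
  there are such coordinates.\<close>

lemma exists_orthogonal_positive_family:
  fixes c :: "'n::finite \<Rightarrow> real"
  assumes "finite N" "k + card N \<le> card {j. c j = 1}"
  shows "\<exists>a::nat \<Rightarrow> complex^'n. (\<forall>i<k. Re (hf c (a i) (a i)) > 0) \<and> (\<forall>i<k. \<forall>v\<in>N. hf c (a i) v = 0)
     \<and> (\<forall>i<k. \<forall>j<k. i \<noteq> j \<longrightarrow> hf c (a i) (a j) = 0)"
  using assms(2)
proof (induction k)
  case 0 then show ?case by auto
next
  case (Suc k)
  then obtain a :: "nat \<Rightarrow> complex^'n" where a: "\<forall>i<k. Re (hf c (a i) (a i)) > 0" "\<forall>i<k. \<forall>v\<in>N. hf c (a i) v = 0"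
     "\<forall>i<k. \<forall>j<k. i \<noteq> j \<longrightarrow> hf c (a i) (a j) = 0" by (metis Suc_leD add_Suc)
  have "card (N \<union> a ` {..<k}) \<le> card N + k"
    using card_Un_le[of N "a ` {..<k}"] card_image_le[of "{..<k}" a] by simp
  then have "card (N \<union> a ` {..<k}) < card {j. c j = 1}" using Suc.prems by simp
  then obtain x where x: "x \<noteq> 0" "\<forall>j. j \<notin> {j. c j = 1} \<longrightarrow> x$j = 0" "\<forall>v\<in>N \<union> a ` {..<k}. hf c x v = 0"
    using exists_supported_orthogonal[of "N \<union> a ` {..<k}" "{j. c j = 1}" c 1] assms(1) by blast
  have p: "Re (hf c x x) > 0" using hf_supported_pos[of x c] x(1,2) by simp
  have o1: "hf c x (a i) = 0" if "i < k" for i using x(3) that by blast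
  then have o2: "hf c (a i) x = 0" if "i < k" for i using hf_sym_0 that by blast
  note o = o1 o2
  show ?case
  proof (intro exI[of _ "a(k := x)"] conjI allI impI ballI)
    fix i assume "i < Suc k"
    then show "0 < Re (hf c ((a(k := x)) i) ((a(k := x)) i))" using a(1) p by (cases "i = k") auto
  next
    fix i v assume "i < Suc k" "v \<in> N"
    then show "hf c ((a(k := x)) i) v = 0" using a(2) x(3) by (cases "i = k") auto
  next
    fix i j assume "i < Suc k" "j < Suc k" "i \<noteq> j"
    then show "hf c ((a(k := x)) i) ((a(k := x)) j) = 0" using a(3) o
      by (cases "i = k"; cases "j = k") auto
  qed
qed

text \<open>Choose \<open>b\<close> so that the combination \<open>T\<close> has no positive
  coordinates. Then the square of \<open>T\<close> is at most 0 by coordinates and at least 0 as a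
  sum of the squares of the \<open>Y i\<close> with nonnegative coefficients. Equality removes the
  negative coordinates of \<open>T\<close> and every \<open>b i\<close> that belongs to a positive
  \<open>Y i\<close>; \<open>trunc\<close> removes the null coordinates.\<close>

lemma orthogonal_family_dependent:
  fixes c :: "'m::finite \<Rightarrow> real" and Y :: "nat \<Rightarrow> complex^'m"
  assumes sg: "\<And>j. c j \<in> {-1, 0, 1}"
    and N: "card {j. c j = 1} < N"
    and orth: "\<And>i j. i < N \<Longrightarrow> j < N \<Longrightarrow> i \<noteq> j \<Longrightarrow> hf c (Y i) (Y j) = 0"
    and nn: "\<And>i. i < N \<Longrightarrow> Re (hf c (Y i) (Y i)) \<ge> 0"
    and trunc: "\<And>i j. i < N \<Longrightarrow> c j = 0 \<Longrightarrow> Y i $ j = 0"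
  shows "\<exists>b. (\<exists>i<N. b i \<noteq> 0) \<and> (\<Sum>i<N. b i *s Y i) = 0 \<and> (\<forall>i<N. Re (hf c (Y i) (Y i)) > 0 \<longrightarrow> b i = 0)"
proof -
  obtain b where b: "\<exists>i\<in>{..<N}. b i \<noteq> 0" "\<forall>j\<in>{j. c j = 1}. (\<Sum>i<N. Y i $ j * b i) = 0"
    using exists_kernel_vector[of "{j. c j = 1}" "{..<N}" "\<lambda>j i. Y i $ j"] N by auto
  define T where "T = (\<Sum>i<N. b i *s Y i)"
  have Tj: "T $ j = (\<Sum>i<N. Y i $ j * b i)" for j
    unfolding T_def by (simp add: sum_component mult.commute)
  have T1: "T $ j = 0" if "c j = 1" for j using b that Tj by auto
  have T0: "T $ j = 0" if "c j = 0" for j unfolding Tj using trunc that by simp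
  have "hf c T T = (\<Sum>i<N. \<Sum>j<N. b i * (cnj (b j) * hf c (Y i) (Y j)))"
    unfolding T_def hf_sum_left hf_scale_left
    unfolding hf_sum_right hf_scale_right
    by (simp add: sum_distrib_left)
  also have "\<dots> = (\<Sum>i<N. \<Sum>j<N. if i = j then b i * cnj (b i) * hf c (Y i) (Y i) else 0)"
    using orth by (intro sum.cong) auto
  also have "\<dots> = (\<Sum>i<N. b i * cnj (b i) * hf c (Y i) (Y i))" by (simp add: sum.delta)
  also have "Re \<dots> = (\<Sum>i<N. (cmod (b i))\<^sup>2 * Re (hf c (Y i) (Y i)))"
    by (simp add: complex_mult_cnj cmod_power2)
  finally have e1: "Re (hf c T T) = (\<Sum>i<N. (cmod (b i))\<^sup>2 * Re (hf c (Y i) (Y i)))" .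
  have nn1: "(cmod (b i))\<^sup>2 * Re (hf c (Y i) (Y i)) \<ge> 0" if "i < N" for i using nn[OF that] by simp
  have np: "c j * (cmod (T$j))\<^sup>2 \<le> 0" for j using sg[of j] T1[of j] by auto
  have z: "Re (hf c T T) = 0"
  proof (rule antisym)
    show "Re (hf c T T) \<le> 0" unfolding hf_self_sum using np by (rule sum_nonpos)
    show "0 \<le> Re (hf c T T)" unfolding e1 by (rule sum_nonneg) (use nn1 in auto)
  qed
  have "T $ j = 0" for j
  proof -
    have "(\<Sum>j\<in>UNIV. - (c j * (cmod (T$j))\<^sup>2)) = 0" using z unfolding hf_self_sum by (simp add: sum_negf)
    then have "- (c j * (cmod (T$j))\<^sup>2) = 0"
      by (subst (asm) sum_nonneg_eq_0_iff) (use np in auto)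
    then show ?thesis using T0 by auto
  qed
  then have "T = 0" by (simp add: vec_eq_iff)
  moreover have "b i = 0" if "i < N" "Re (hf c (Y i) (Y i)) > 0" for i
  proof -
    have "(cmod (b i))\<^sup>2 * Re (hf c (Y i) (Y i)) = 0"
      using z unfolding e1 by (subst (asm) sum_nonneg_eq_0_iff) (use nn1 that in auto)
    then show ?thesis using that by simp
  qed
  ultimately show ?thesis using b unfolding T_def by auto
qed

subsection \<open>Holomorphic curves and maps\<close>

lemma norm_vec_scale: "norm (c *s v) = cmod c * norm (v :: complex^'n)"
  by (simp add: norm_vec_def L2_set_right_distrib norm_mult)

lemma bounded_linear_scale_vec: "bounded_linear (\<lambda>h. h *s (v :: complex^'n))"
proof (rule bounded_linear_intro[where K = "norm v"])
  show "(x + y) *s v = x *s v + y *s v" for x y by (simp add: vector_sadd_rdistrib)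
  show "(r *\<^sub>R x) *s v = r *\<^sub>R (x *s v)" for r x by (simp add: vec_eq_iff)
  show "norm (x *s v) \<le> norm x * norm v" for x by (simp add: norm_vec_scale)
qed

definition hol_curve :: "complex set \<Rightarrow> (complex \<Rightarrow> complex^'n) \<Rightarrow> bool" where
  "hol_curve T \<gamma> \<longleftrightarrow> (\<forall>t\<in>T. \<exists>d. (\<gamma> has_derivative (\<lambda>h. h *s d)) (at t))"

lemma hol_curve_const: "hol_curve T (\<lambda>t. a)"
  unfolding hol_curve_def by (auto intro!: exI[of _ 0] simp: has_derivative_const)

lemma hol_curve_add:
  assumes "hol_curve T \<gamma>" "hol_curve T \<delta>"
  shows "hol_curve T (\<lambda>t. \<gamma> t + \<delta> t)"
  unfolding hol_curve_def
proof
  fix t assume t: "t \<in> T"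
  from assms t obtain d d' where "(\<gamma> has_derivative (\<lambda>h. h *s d)) (at t)" "(\<delta> has_derivative (\<lambda>h. h *s d')) (at t)"
    unfolding hol_curve_def by blast
  from has_derivative_add[OF this] show "\<exists>d. ((\<lambda>t. \<gamma> t + \<delta> t) has_derivative (\<lambda>h. h *s d)) (at t)"
    by (intro exI[of _ "d + d'"]) (simp add: vector_add_ldistrib)
qed

lemma hol_curve_scale:
  assumes "\<phi> holomorphic_on T" "open T"
  shows "hol_curve T (\<lambda>t. \<phi> t *s v)"
  unfolding hol_curve_def
proof
  fix t assume t: "t \<in> T"
  from assms t obtain d where "(\<phi> has_field_derivative d) (at t)"
    unfolding holomorphic_on_open[OF assms(2)] by blast
  then have "(\<phi> has_derivative (\<lambda>h. d * h)) (at t)" by (simp add: has_field_derivative_def)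
  from bounded_linear.has_derivative[OF bounded_linear_scale_vec this]
  show "\<exists>d. ((\<lambda>t. \<phi> t *s v) has_derivative (\<lambda>h. h *s d)) (at t)"
    by (intro exI[of _ "d *s v"]) (simp add: mult.commute)
qed

lemmas hol_curve_intros = hol_curve_const hol_curve_add hol_curve_scale

lemma cholo_on_frechet:
  assumes "cholo_on S g" "x \<in> S"
  shows "(g has_derivative frechet_derivative g (at x)) (at x)"
    and "frechet_derivative g (at x) (c *s v) = c *s frechet_derivative g (at x) v"
proof -
  obtain g' where g': "(g has_derivative g') (at x)" "\<And>c v. g' (c *s v) = c *s g' v"
    using assms unfolding cholo_on_def by blast
  have "g' = frechet_derivative g (at x)" using frechet_derivative_at[OF g'(1)] .
  then show "(g has_derivative frechet_derivative g (at x)) (at x)"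
    "frechet_derivative g (at x) (c *s v) = c *s frechet_derivative g (at x) v" using g' by auto
qed

lemma cholo_on_continuous: "cholo_on S g \<Longrightarrow> continuous_on S g"
  by (metis cholo_on_frechet(1) continuous_at_imp_continuous_on has_derivative_continuous)

lemma cholo_on_subset: "cholo_on S g \<Longrightarrow> T \<subseteq> S \<Longrightarrow> cholo_on T g"
  unfolding cholo_on_def by blast

lemma cholo_comp_curve:
  assumes g: "cholo_on S g" and \<gamma>: "(\<gamma> has_derivative (\<lambda>h. h *s d)) (at t)" "\<gamma> t \<in> S"
  shows "((\<lambda>t. g (\<gamma> t) $ i) has_field_derivative frechet_derivative g (at (\<gamma> t)) d $ i) (at t)"
proof -
  have "((\<lambda>t. g (\<gamma> t)) has_derivative (\<lambda>h. frechet_derivative g (at (\<gamma> t)) (h *s d))) (at t)"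
    using has_derivative_compose[OF \<gamma>(1) cholo_on_frechet(1)[OF g \<gamma>(2)]] by simp
  then have "((\<lambda>t. g (\<gamma> t) $ i) has_derivative (\<lambda>h. frechet_derivative g (at (\<gamma> t)) (h *s d) $ i)) (at t)"
    by (rule bounded_linear.has_derivative[OF bounded_linear_vec_nth])
  then have "((\<lambda>t. g (\<gamma> t) $ i) has_derivative (\<lambda>h. frechet_derivative g (at (\<gamma> t)) d $ i * h)) (at t)"
    unfolding cholo_on_frechet(2)[OF g \<gamma>(2)] by (simp add: mult.commute)
  then show ?thesis by (rule has_derivative_imp_has_field_derivative) simp
qed

lemma holomorphic_comp_curve:
  assumes "cholo_on S g" "hol_curve T \<gamma>" "\<And>t. t \<in> T \<Longrightarrow> \<gamma> t \<in> S"
  shows "(\<lambda>t. g (\<gamma> t) $ i) holomorphic_on T"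
proof (rule holomorphic_onI)
  fix t assume t: "t \<in> T"
  then obtain d where "(\<gamma> has_derivative (\<lambda>h. h *s d)) (at t)" using assms(2) unfolding hol_curve_def by blast
  from cholo_comp_curve[OF assms(1) this assms(3)[OF t]]
  show "(\<lambda>t. g (\<gamma> t) $ i) field_differentiable at t within T"
    using field_differentiable_at_within field_differentiable_def by blast
qed

lemma holomorphic_hf_curve:
  assumes "cholo_on S g" "hol_curve T \<gamma>" "\<And>t. t \<in> T \<Longrightarrow> \<gamma> t \<in> S"
  shows "(\<lambda>t. hf c (g (\<gamma> t)) v) holomorphic_on T"
  unfolding hf_def by (intro holomorphic_intros holomorphic_comp_curve[OF assms]) auto

text \<open>The form is conjugate linear in its second argument; conjugating the parameter there
  restores holomorphy. For \<gamma> = \<delta>, real parameters give the diagonal values of the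
  kernel, which is the polarisation device.\<close>

lemma holomorphic_hf_curve2:
  assumes "cholo_on S g" "hol_curve (ball 0 r) \<gamma>" "hol_curve (ball 0 r) \<delta>"
    "\<And>t. t \<in> ball 0 r \<Longrightarrow> \<gamma> t \<in> S" "\<And>t. t \<in> ball 0 r \<Longrightarrow> \<delta> t \<in> S"
  shows "(\<lambda>t. hf c (g (\<gamma> t)) (g (\<delta> (cnj t)))) holomorphic_on (ball 0 r)"
proof -
  have b: "cnj ` ball 0 r = (ball 0 r :: complex set)"
  proof
    show "cnj ` ball 0 r \<subseteq> ball 0 r" by auto
    show "(ball 0 r :: complex set) \<subseteq> cnj ` ball 0 r"
    proof
      fix z :: complex assume "z \<in> ball 0 r"
      then have "cnj z \<in> ball 0 r" "z = cnj (cnj z)" by auto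
      then show "z \<in> cnj ` ball 0 r" by blast
    qed
  qed
  have "(\<lambda>t. g (\<delta> t) $ i) holomorphic_on cnj ` ball 0 r" for i
    unfolding b by (rule holomorphic_comp_curve[OF assms(1,3,5)])
  from holomorphic_on_compose_cnj_cnj[OF this open_ball]
  have "(\<lambda>t. cnj (g (\<delta> (cnj t)) $ i)) holomorphic_on ball 0 r" for i by (simp add: o_def)
  then show ?thesis
    unfolding hf_def by (intro holomorphic_intros holomorphic_comp_curve[OF assms(1,2,4)]) auto
qed

text \<open>The real parameters accumulate at 0, so the identity theorem applies on the
  disc.\<close>

lemma holomorphic_zero_from_reals:
  assumes "F holomorphic_on ball 0 r" "\<And>s. \<bar>s\<bar> < r \<Longrightarrow> F (of_real s) = 0" "w \<in> ball 0 r"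
  shows "F w = 0"
proof (rule analytic_continuation[OF assms(1) open_ball connected_ball, of "of_real ` {s::real. \<bar>s\<bar> < r}" 0])
  have r: "0 < r" using assms(3) by (metis dist_pos_lt dist_self ball_eq_empty empty_iff not_le)
  show "of_real ` {s. \<bar>s\<bar> < r} \<subseteq> (ball 0 r :: complex set)" by (auto simp: dist_norm)
  show "0 \<in> ball 0 r" using r by simp
  show "0 islimpt (of_real ` {s::real. \<bar>s\<bar> < r} :: complex set)"
    unfolding islimpt_approachable
  proof (intro allI impI)
    fix e :: real assume "e > 0"
    then have "of_real (min e r / 2) \<noteq> (0::complex)" "dist (of_real (min e r / 2)) (0::complex) < e" "\<bar>min e r / 2\<bar> < r"
      using r by (auto simp: dist_norm simp del: of_real_divide)
    then show "\<exists>x'\<in>of_real ` {s. \<bar>s\<bar> < r}. x' \<noteq> (0::complex) \<and> dist x' 0 < e"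
      by blast
  qed
  show "F z = 0" if "z \<in> of_real ` {s. \<bar>s\<bar> < r}" for z using assms(2) that by auto
qed (use assms in auto)

section \<open>Identity theorem along complex lines\<close>

definition line_hol :: "(complex^'n) set \<Rightarrow> (complex^'n \<Rightarrow> complex) \<Rightarrow> bool" where
  "line_hol D \<psi> \<longleftrightarrow> (\<forall>a b. (\<lambda>t. \<psi> (a + t *s b)) holomorphic_on {t. a + t *s b \<in> D})"

lemma open_line_preimage:
  assumes "open D"
  shows "open {t. a + t *s b \<in> (D::(complex^'n) set)}"
proof -
  have "continuous_on UNIV (\<lambda>t. a + t *s b)" by (intro continuous_intros)
  from open_vimage[OF assms this] show ?thesis by (simp add: vimage_def)
qed

lemma hol_curve_line: "open T \<Longrightarrow> hol_curve T (\<lambda>t. a + t *s b)"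
  by (intro hol_curve_intros holomorphic_intros)

lemma line_hol_comp: "cholo_on D g \<Longrightarrow> open D \<Longrightarrow> line_hol D (\<lambda>x. g x $ i)"
  unfolding line_hol_def
  by (intro allI holomorphic_comp_curve[where S = D] hol_curve_line open_line_preimage) auto

lemma line_hol_hf: "cholo_on D g \<Longrightarrow> open D \<Longrightarrow> line_hol D (\<lambda>x. hf c (g x) v)"
  unfolding line_hol_def
  by (intro allI holomorphic_hf_curve[where S = D] hol_curve_line open_line_preimage) auto

lemma line_hol_mult: "line_hol D f \<Longrightarrow> line_hol D g \<Longrightarrow> line_hol D (\<lambda>x. f x * g x)"
  unfolding line_hol_def by (auto intro: holomorphic_on_mult)

lemma line_hol_diff: "line_hol D f \<Longrightarrow> line_hol D g \<Longrightarrow> line_hol D (\<lambda>x. f x - g x)"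
  unfolding line_hol_def by (auto intro: holomorphic_on_diff)

lemma line_hol_mv: "line_hol D (\<lambda>x. ((M::complex^'n^'m) *v x) $ i)"
proof -
  have "(M *v (a + t *s b)) $ i = (M *v a) $ i + t * (M *v b) $ i" for a b t
    by (simp add: matrix_vector_right_distrib vector_scalar_commute)
  then show ?thesis unfolding line_hol_def by (auto intro!: holomorphic_intros)
qed

lemma line_hol_hf_id: "line_hol D (\<lambda>x. hf c x v)"
  unfolding line_hol_def hf_lin by (auto intro!: holomorphic_intros)

text \<open>Join \<open>x\<close> to a point of \<open>U\<close> by a complex line. Its trace on
  \<open>D\<close> is convex, hence connected, and its trace on \<open>U\<close> is open and
  nonempty, so one variable suffices.\<close>

lemma line_hol_zero:
  assumes "line_hol D \<psi>" "open D" "convex D" "open U" "U \<subseteq> D" "U \<noteq> {}" "\<And>x. x \<in> U \<Longrightarrow> \<psi> x = 0" "x \<in> D"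
  shows "\<psi> x = 0"
proof -
  obtain a where a: "a \<in> U" using assms by auto
  define b where "b = x - a"
  define T where "T = {t. a + t *s b \<in> D}"
  have cT: "convex T"
    unfolding convex_alt
  proof (intro ballI allI impI)
    fix s t u assume st: "s \<in> T" "t \<in> T" and "0 \<le> u \<and> u \<le> (1::real)"
    then have "(1 - u) *\<^sub>R (a + s *s b) + u *\<^sub>R (a + t *s b) \<in> D"
      using \<open>convex D\<close> unfolding convex_alt T_def by blast
    moreover have "(1 - u) *\<^sub>R (a + s *s b) + u *\<^sub>R (a + t *s b) = a + ((1 - u) *\<^sub>R s + u *\<^sub>R t) *s b"
      unfolding vec_eq_iff vector_add_component vector_smult_component vector_scaleR_component
      by (simp add: algebra_simps scaleR_conv_of_real)
    ultimately show "(1 - u) *\<^sub>R s + u *\<^sub>R t \<in> T" unfolding T_def by simp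
  qed
  have "\<psi> (a + 1 *s b) = 0"
  proof (rule analytic_continuation[of "\<lambda>t. \<psi> (a + t *s b)" T "{t. a + t *s b \<in> U}" 0 1])
    show "(\<lambda>t. \<psi> (a + t *s b)) holomorphic_on T" using assms(1) unfolding line_hol_def T_def by blast
    show "open T" unfolding T_def by (rule open_line_preimage[OF assms(2)])
    show "connected T" using cT convex_connected by blast
    show "{t. a + t *s b \<in> U} \<subseteq> T" "0 \<in> T" using assms a by (auto simp: T_def)
    show "0 islimpt {t. a + t *s b \<in> U}"
      by (rule interior_limit_point) (use open_line_preimage[OF assms(4), of a b] a in \<open>simp add: interior_open\<close>)
    show "1 \<in> T" using assms(8) by (simp add: T_def b_def)
  qed (use assms in auto)
  then show ?thesis by (simp add: b_def)
qed

lemma line_derivative: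
  assumes "cholo_on S g" "x \<in> S"
  shows "((\<lambda>t. g (x + t *s v) $ i) has_field_derivative frechet_derivative g (at x) v $ i) (at 0)"
proof -
  have "((\<lambda>t. x + t *s v) has_derivative (\<lambda>h. 0 + h *s v)) (at (0::complex))"
    by (intro derivative_intros bounded_linear.has_derivative[OF bounded_linear_scale_vec] has_derivative_add
        has_derivative_const has_derivative_ident)
  then show ?thesis using cholo_comp_curve[OF assms(1), of "\<lambda>t. x + t *s v" v 0 i] assms(2) by simp
qed

lemma line_derivative_hf:
  assumes "cholo_on S g" "x \<in> S"
  shows "((\<lambda>t. hf c (g (x + t *s v)) w) has_field_derivative hf c (frechet_derivative g (at x) v) w) (at 0)"
  unfolding hf_def
  by (intro DERIV_sum DERIV_cmult_right DERIV_cmult line_derivative[OF assms])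

lemma frechet_derivative_add:
  assumes "cholo_on S g" "x \<in> S"
  shows "frechet_derivative g (at x) (u + v) = frechet_derivative g (at x) u + frechet_derivative g (at x) v"
  using linear_add[OF has_derivative_linear[OF cholo_on_frechet(1)[OF assms]]] .

text \<open>Cauchy's inequality, applied to the difference of \<open>g\<close> along the parallel
  lines through \<open>y\<close> and \<open>x0\<close>, bounds the difference of the derivatives;
  uniform continuity of \<open>g\<close> makes that difference small on the whole disc.\<close>

lemma tendsto_frechet_derivative:
  fixes g :: "complex^'n \<Rightarrow> complex^'m"
  assumes g: "cholo_on D g" and D: "open D" "x0 \<in> D"
  shows "((\<lambda>y. frechet_derivative g (at y) v) \<longlongrightarrow> frechet_derivative g (at x0) v) (nhds x0)"
proof (rule vec_tendstoI)
  fix i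
  obtain r where r: "r > 0" "cball x0 r \<subseteq> D" using D open_contains_cball by blast
  \<comment> \<open>With this radius the discs through \<open>x0\<close> and through any
    \<open>y\<close> within \<open>r/2\<close> of it stay in \<open>cball x0 r\<close>; the summand
    1 covers \<open>v = 0\<close>.\<close>
  define \<rho> where "\<rho> = r / (2 * (norm v + 1))"
  have \<rho>: "\<rho> > 0" "\<rho> * norm v \<le> r / 2"
    using r by (auto simp: \<rho>_def field_simps add_pos_nonneg)
  have "uniformly_continuous_on (cball x0 r) g"
    using cholo_on_continuous[OF g] r continuous_on_subset compact_uniformly_continuous compact_cball by blast
  then have uc: "\<And>e. e > 0 \<Longrightarrow> \<exists>d>0. \<forall>x\<in>cball x0 r. \<forall>y\<in>cball x0 r. dist y x < d \<longrightarrow> dist (g y) (g x) < e"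
    unfolding uniformly_continuous_on_def by blast
  show "((\<lambda>y. frechet_derivative g (at y) v $ i) \<longlongrightarrow> frechet_derivative g (at x0) v $ i) (nhds x0)"
    unfolding tendsto_iff eventually_nhds_metric
  proof (intro allI impI)
    fix e :: real assume e: "e > 0"
    obtain d where d: "d > 0" "\<forall>x\<in>cball x0 r. \<forall>y\<in>cball x0 r. dist y x < d \<longrightarrow> dist (g y) (g x) < e / 2 * \<rho>"
      using uc[of "e / 2 * \<rho>"] e \<rho> by auto
    show "\<exists>d>0. \<forall>y. dist y x0 < d \<longrightarrow> dist (frechet_derivative g (at y) v $ i) (frechet_derivative g (at x0) v $ i) < e"
    proof (intro exI[of _ "min d (r/2)"] conjI allI impI)
      show "0 < min d (r/2)" using d r by auto
      fix y assume y: "dist y x0 < min d (r/2)"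
      have inr: "y + t *s v \<in> cball x0 r" "x0 + t *s v \<in> cball x0 r" if "cmod t \<le> \<rho>" for t
      proof -
        have "norm (t *s v) \<le> \<rho> * norm v" unfolding norm_vec_scale by (rule mult_right_mono) (use that in auto)
        then have n: "norm (t *s v) \<le> r / 2" using \<rho> by linarith
        have "dist x0 (y + t *s v) \<le> dist x0 y + norm (t *s v)"
          by (metis dist_norm dist_triangle add_diff_cancel_left' norm_minus_commute)
        then show "y + t *s v \<in> cball x0 r" using n y by (simp add: dist_commute)
        show "x0 + t *s v \<in> cball x0 r" using n r by (simp add: dist_norm)
      qed
      define T where "T = {t. y + t *s v \<in> D} \<inter> {t. x0 + t *s v \<in> D}"
      have T: "open T" "cball 0 \<rho> \<subseteq> T" unfolding T_def
        using open_line_preimage[OF D(1)] inr r by auto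
      define \<phi> where "\<phi> = (\<lambda>t. g (y + t *s v) $ i - g (x0 + t *s v) $ i)"
      have h: "\<phi> holomorphic_on T" unfolding \<phi>_def
        by (intro holomorphic_intros holomorphic_comp_curve[OF g] hol_curve_line T) (auto simp: T_def)
      have yD: "y \<in> D" using T(2) \<rho> unfolding T_def by (auto dest: subsetD[of _ _ 0])
      have "norm ((deriv ^^ 1) \<phi> 0) \<le> fact 1 * (e / 2 * \<rho>) / \<rho> ^ 1"
      proof (rule Cauchy_inequality)
        show "\<phi> holomorphic_on ball 0 \<rho>" using h T(2) ball_subset_cball by (blast intro: holomorphic_on_subset)
        show "continuous_on (cball 0 \<rho>) \<phi>"
          using h T(2) by (blast intro: holomorphic_on_imp_continuous_on continuous_on_subset)
        show "\<rho> > 0" by fact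
        fix t :: complex assume "norm (0 - t) = \<rho>"
        then have t: "cmod t \<le> \<rho>" by simp
        have "dist (y + t *s v) (x0 + t *s v) < d" using y by (simp add: dist_norm)
        then have "dist (g (y + t *s v)) (g (x0 + t *s v)) < e / 2 * \<rho>" using d inr[OF t] by blast
        moreover have "norm (\<phi> t) \<le> dist (g (y + t *s v)) (g (x0 + t *s v))"
          unfolding \<phi>_def dist_norm vector_minus_component[symmetric] by (rule Finite_Cartesian_Product.norm_nth_le)
        ultimately show "norm (\<phi> t) \<le> e / 2 * \<rho>" by linarith
      qed
      moreover have "deriv \<phi> 0 = frechet_derivative g (at y) v $ i - frechet_derivative g (at x0) v $ i"
        unfolding \<phi>_def by (intro DERIV_imp_deriv DERIV_diff line_derivative[OF g] yD D)
      ultimately have "norm (frechet_derivative g (at y) v $ i - frechet_derivative g (at x0) v $ i) \<le> e / 2"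
        using \<rho> by simp
      then show "dist (frechet_derivative g (at y) v $ i) (frechet_derivative g (at x0) v $ i) < e"
        using e by (simp add: dist_norm)
    qed
  qed
qed

subsection \<open>Preservation of orthogonality\<close>

text \<open>\<open>g\<close> stands for a local lift whose null coordinates have been set to zero
  (\<open>trunc\<close>). By \<open>nonrad\<close> the set \<open>D\<close> avoids the radical, so
  each null point of \<open>D\<close> is a limit of positive and of negative points.\<close>

locale sign_map =
  fixes c :: "'n::finite \<Rightarrow> real" and c' :: "'m::finite \<Rightarrow> real"
    and g :: "complex^'n \<Rightarrow> complex^'m" and D :: "(complex^'n) set"
  assumes sgn: "\<And>j. c j \<in> {-1, 0, 1}" and sgn': "\<And>j. c' j \<in> {-1, 0, 1}"
    and open_D: "open D" and convex_D: "convex D" and holo: "cholo_on D g"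
    and trunc: "\<And>x j. x \<in> D \<Longrightarrow> c' j = 0 \<Longrightarrow> g x $ j = 0"
    and pos: "\<And>x. x \<in> D \<Longrightarrow> Re (hf c x x) > 0 \<Longrightarrow> Re (hf c' (g x) (g x)) > 0"
    and neg: "\<And>x. x \<in> D \<Longrightarrow> Re (hf c x x) < 0 \<Longrightarrow> Re (hf c' (g x) (g x)) < 0"
    and nonrad: "\<And>x. x \<in> D \<Longrightarrow> Re (hf c x (hflip c x)) > 0"
begin

abbreviation "H \<equiv> hf c"
abbreviation "K x w \<equiv> hf c' (g x) (g w)"
abbreviation "J \<equiv> hflip c"

lemma tendsto_g [tendsto_intros]:
  assumes "(f \<longlongrightarrow> x) F" "x \<in> D"
  shows "((\<lambda>t. g (f t)) \<longlongrightarrow> g x) F"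
  using cholo_on_continuous[OF holo] continuous_on_eq_continuous_at[OF open_D] isCont_tendsto_compose assms
  by blast

lemma eventually_D: "(f \<longlongrightarrow> x) F \<Longrightarrow> x \<in> D \<Longrightarrow> eventually (\<lambda>t. f t \<in> D) F"
  using topological_tendstoD[OF _ open_D] .

text \<open>\<open>J x\<close> is null as well and has a nonnegative real pairing with
  \<open>x\<close>. Off the radical the form therefore has the sign of \<open>Re t\<close> on this
  complex line: real \<open>t\<close> cross from negative to positive points, imaginary
  \<open>t\<close> stay null.\<close>

lemma H_flip_line:
  assumes "H x x = 0"
  shows "H (x + t *s J x) (x + t *s J x) = of_real (2 * Re t * Re (H x (J x)))"
proof -
  have r: "H x (J x) = of_real (Re (H x (J x)))" unfolding hf_hflip_self by simp
  have "H (x + t *s J x) (x + t *s J x) = (t + cnj t) * H x (J x)"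
    using assms hf_hflip_hflip[of c x x, OF sgn] hflip_commute[of c x x]
    by (simp add: hf_lin algebra_simps)
  also have "\<dots> = of_real (2 * Re t) * of_real (Re (H x (J x)))"
    using complex_add_cnj[of t] r by simp
  finally show ?thesis by simp
qed

text \<open>Along the real line in direction \<open>J x\<close>, the point \<open>x\<close> is a
  limit of positive points from one side and of negative points from the other, so the square of its
  image is squeezed to 0.\<close>

lemma K_null:
  assumes x: "x \<in> D" "H x x = 0"
  shows "K x x = 0"
proof -
  define f where "f = (\<lambda>s::real. Re (K (x + of_real s *s J x) (x + of_real s *s J x)))"
  have l0: "((\<lambda>s::real. x + of_real s *s J x) \<longlongrightarrow> x + of_real 0 *s J x) (at 0)"
    by (intro tendsto_intros)
  then have l: "((\<lambda>s::real. x + of_real s *s J x) \<longlongrightarrow> x) (at 0)" by simp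
  have f: "(f \<longlongrightarrow> Re (K x x)) (at 0)" unfolding f_def
    by (intro tendsto_intros l x)
  have ev: "eventually (\<lambda>s::real. x + of_real s *s J x \<in> D) (at 0)" by (rule eventually_D[OF l x(1)])
  have E: "Re (H x (J x)) > 0" using nonrad[OF x(1)] .
  have "Re (K x x) \<ge> 0"
  proof (rule tendsto_lowerbound[of f _ "at_right 0"])
    show "(f \<longlongrightarrow> Re (K x x)) (at_right 0)" using f by (rule tendsto_mono[rotated]) (simp add: at_le)
    have "eventually (\<lambda>s::real. x + of_real s *s J x \<in> D \<and> s > 0) (at_right 0)"
      using ev at_le[of "{0::real<..}" UNIV 0] by (auto simp: eventually_at_filter elim: eventually_mono)
    then show "eventually (\<lambda>s. 0 \<le> f s) (at_right 0)"
      by (rule eventually_mono) (use E in \<open>auto simp: f_def H_flip_line[OF x(2)] intro!: less_imp_le pos\<close>)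
  qed simp
  moreover have "Re (K x x) \<le> 0"
  proof (rule tendsto_upperbound[of f _ "at_left 0"])
    show "(f \<longlongrightarrow> Re (K x x)) (at_left 0)" using f by (rule tendsto_mono[rotated]) (simp add: at_le)
    have "eventually (\<lambda>s::real. x + of_real s *s J x \<in> D \<and> s < 0) (at_left 0)"
      using ev by (auto simp: eventually_at_filter elim: eventually_mono)
    then show "eventually (\<lambda>s. f s \<le> 0) (at_left 0)"
      by (rule eventually_mono) (use E in \<open>auto simp: f_def H_flip_line[OF x(2)] mult_neg_pos intro!: less_imp_le neg\<close>)
  qed simp
  ultimately show ?thesis by (simp add: complex_eq_iff)
qed

text \<open>An orthogonal pair \<open>z\<close>, \<open>w\<close> near a null point is of the form \<open>\<gamma> \<i>\<close>, \<open>\<gamma> (-\<i>)\<close> for a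
  holomorphic curve \<open>\<gamma>\<close> that is null at real parameters, so orthogonality of the images
  follows from the one-variable identity theorem.\<close>

lemma K_orthogonal:
  assumes z0: "z0 \<in> D" "H z0 z0 = 0"
  shows "\<exists>\<rho>>0. ball z0 \<rho> \<subseteq> D \<and> (\<forall>z\<in>ball z0 \<rho>. \<forall>w\<in>ball z0 \<rho>. H z w = 0 \<longrightarrow> K z w = 0)"
proof -
  obtain r0 where r0: "r0 > 0" "ball z0 r0 \<subseteq> D" using open_D z0 open_contains_ball by blast
  define m where "m = J z0"
  define E where "E = Re (H z0 m)"
  have E: "E > 0" "H z0 m = of_real E" using nonrad[OF z0(1)] unfolding E_def m_def by (auto simp: hf_hflip_self)
  have mm: "H m m = 0" unfolding m_def hf_hflip_hflip[OF sgn] by (fact z0)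
  \<comment> \<open>\<open>A\<close> and \<open>B\<close> solve \<open>z = A + \<i> B\<close>,
    \<open>w = A - \<i> B\<close>; they give the affine part of the curve through \<open>z\<close>
    and \<open>w\<close>.\<close>
  define A where "A = (\<lambda>z w. (1/2) *s (z + w) :: complex^'n)"
  define B where "B = (\<lambda>z w. (-\<i>/2) *s (z - w) :: complex^'n)"
  \<comment> \<open>These bounds keep the denominator of \<delta> below at least \<open>E/2\<close>
    in absolute value and the curve within \<open>r0\<close> of \<open>z0\<close>, for all
    parameters in the disc of radius 2, which contains \<i> and -\<i>.\<close>
  define P where "P = (\<lambda>z w. norm (H (A z w) m - of_real E) < E / 4 \<and> norm (H (B z w) m) < E / 8 \<and>
     norm (A z w - z0) < r0 / 4 \<and> norm (B z w) < r0 / 8 \<and> 5 * norm (H (A z w) (A z w)) / E * norm m < r0 / 4)"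
  let ?F = "nhds z0 \<times>\<^sub>F nhds z0"
  have f1: "(fst \<longlongrightarrow> z0) ?F" and f2: "(snd \<longlongrightarrow> z0) ?F" by (rule filterlim_fst filterlim_snd)+
  have tA: "((\<lambda>p. A (fst p) (snd p)) \<longlongrightarrow> A z0 z0) ?F" and tB: "((\<lambda>p. B (fst p) (snd p)) \<longlongrightarrow> B z0 z0) ?F"
    unfolding A_def B_def by (intro tendsto_intros f1 f2)+
  have AB: "A z0 z0 = z0" "B z0 z0 = 0" unfolding A_def B_def by (simp_all add: vec_eq_iff)
  have "((\<lambda>p. norm (H (A (fst p) (snd p)) m - of_real E)) \<longlongrightarrow> norm (H (A z0 z0) m - of_real E)) ?F"
    "((\<lambda>p. norm (H (B (fst p) (snd p)) m)) \<longlongrightarrow> norm (H (B z0 z0) m)) ?F"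
    "((\<lambda>p. norm (A (fst p) (snd p) - z0)) \<longlongrightarrow> norm (A z0 z0 - z0)) ?F"
    "((\<lambda>p. norm (B (fst p) (snd p))) \<longlongrightarrow> norm (B z0 z0)) ?F"
    "((\<lambda>p. 5 * norm (H (A (fst p) (snd p)) (A (fst p) (snd p))) / E * norm m) \<longlongrightarrow> 5 * norm (H (A z0 z0) (A z0 z0)) / E * norm m) ?F"
    using E(1) by (intro tendsto_intros tA tB; simp)+
  then have "eventually (\<lambda>p. P (fst p) (snd p)) ?F"
    unfolding P_def AB E(2) z0(2)
    using E(1) r0(1) by (intro eventually_conj order_tendstoD(2)) auto
  then obtain Q where Q: "eventually Q (nhds z0)" "\<And>z w. Q z \<Longrightarrow> Q w \<Longrightarrow> P z w"
    unfolding eventually_prod_same by auto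
  then obtain \<rho> where \<rho>: "\<rho> > 0" "\<And>z. dist z z0 < \<rho> \<Longrightarrow> Q z" unfolding eventually_nhds_metric by blast
  have main: "K z w = 0" if P: "P z w" and zw: "H z w = 0" for z w
  proof -
    define a where "a = A z w"
    define b where "b = B z w"
    define N where "N = H a a"
    \<comment> \<open>A multiple of the null vector \<open>m\<close> corrects the square
      \<open>(1 + l^2) N\<close> of \<open>a + l b\<close> to 0 for real \<open>l\<close>.
      Conjugates fall only on constants, so \<delta> is holomorphic, and the factor
      \<open>1 + l^2\<close> makes it vanish at \<i> and -\<i>, where the curve must pass through
      \<open>z\<close> and \<open>w\<close>.\<close>
    define \<delta> where "\<delta> = (\<lambda>l. - (1 + l^2) * N / (2 * (cnj (H a m) + l * cnj (H b m))))"
    define \<gamma> where "\<gamma> = (\<lambda>l. (a + l *s b) + \<delta> l *s m)"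
    have P': "norm (H a m - of_real E) < E / 4" "norm (H b m) < E / 8" "norm (a - z0) < r0 / 4" "norm b < r0 / 8"
      "5 * norm N / E * norm m < r0 / 4" using P unfolding P_def a_def b_def N_def by auto
    have den: "norm (cnj (H a m) + l * cnj (H b m)) \<ge> E / 2" if "l \<in> ball 0 2" for l
    proof -
      have "norm (l * cnj (H b m)) \<le> 2 * (E / 8)" unfolding norm_mult using that P'(2) by (intro mult_mono) auto
      moreover have "E - E / 4 \<le> norm (H a m)"
      proof -
        have "norm (of_real E :: complex) = E" using E by simp
        then show ?thesis using norm_triangle_ineq2[of "of_real E" "of_real E - H a m"] P'(1) by (simp add: norm_minus_commute)
      qed
      moreover have "norm (cnj (H a m) + l * cnj (H b m)) \<ge> norm (cnj (H a m)) - norm (l * cnj (H b m))"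
        by (metis norm_diff_ineq)
      ultimately show ?thesis by simp
    qed
    have den0: "cnj (H a m) + l * cnj (H b m) \<noteq> 0" if "l \<in> ball 0 2" for l using den[OF that] E(1) by force
    have \<delta>_bd: "norm (\<delta> l) \<le> 5 * norm N / E" if l: "l \<in> ball 0 2" for l
    proof -
      have "norm (1 + l^2) \<le> 1 + norm l ^ 2" by (metis norm_one norm_power norm_triangle_ineq)
      also have "\<dots> \<le> 1 + 2^2" using l by (intro add_left_mono power_mono) auto
      finally have "norm (1 + l^2) \<le> 5" by simp
      then have "norm (- (1 + l^2) * N) \<le> 5 * norm N" unfolding norm_mult norm_minus_cancel by (intro mult_right_mono) auto
      moreover have "norm (2 * (cnj (H a m) + l * cnj (H b m))) \<ge> 2 * (E / 2)"
        unfolding norm_mult[of 2] using den[OF l] by simp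
      ultimately have "norm (\<delta> l) \<le> (5 * norm N) / (2 * (E / 2))" unfolding \<delta>_def norm_divide
        using E(1) by (intro frac_le) auto
      then show ?thesis by simp
    qed
    have inD: "\<gamma> l \<in> D" if l: "l \<in> ball 0 2" for l
    proof -
      have "norm (\<gamma> l - z0) = norm ((a - z0) + l *s b + \<delta> l *s m)" unfolding \<gamma>_def by (simp add: algebra_simps)
      also have "\<dots> \<le> norm (a - z0) + norm (l *s b) + norm (\<delta> l *s m)" by (metis norm_triangle_ineq norm_triangle_mono order_refl)
      also have "\<dots> \<le> norm (a - z0) + 2 * norm b + 5 * norm N / E * norm m"
        unfolding norm_vec_scale using l by (intro add_mono mult_right_mono \<delta>_bd) auto
      also have "\<dots> < r0" using P' r0(1) by linarith
      finally show ?thesis using r0(2) by (auto simp: dist_norm norm_minus_commute)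
    qed
    have \<delta>_hol: "\<delta> holomorphic_on ball 0 2" unfolding \<delta>_def using den0 by (intro holomorphic_intros) (simp_all del: distrib_left_numeral)
    have curve: "hol_curve (ball 0 2) \<gamma>" unfolding \<gamma>_def
      by (intro hol_curve_intros \<delta>_hol open_ball holomorphic_intros)
    have F: "(\<lambda>l. K (\<gamma> l) (\<gamma> (cnj l))) holomorphic_on ball 0 2"
      by (rule holomorphic_hf_curve2[OF holo curve curve inD inD])
    have wz: "H w z = 0" using zw hf_sym_0 by blast
    \<comment> \<open>Here orthogonality of \<open>z\<close> and \<open>w\<close> enters:
      \<open>H a a = H b b\<close> and \<open>H a b + H b a = 0\<close>, so for real
      \<open>l\<close> the square of \<open>a + l b\<close> has no linear term.\<close>
    have ab: "H a a = (H z z + H w w) / 4" "H b b = (H z z + H w w) / 4" "H a b = \<i>/4 * (H z z - H w w)" "H b a = -\<i>/4 * (H z z - H w w)"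
      unfolding a_def b_def A_def B_def hf_lin zw wz by (auto simp: algebra_simps)
    have Nr: "cnj N = N" unfolding N_def by (rule hf_cnj)
    have null: "H (\<gamma> (of_real s)) (\<gamma> (of_real s)) = 0" if "\<bar>s\<bar> < 2" for s :: real
    proof -
      let ?l = "of_real s :: complex"
      have l: "?l \<in> ball 0 2" using that by simp
      define q where "q = H a m + ?l * H b m"
      have q0: "q \<noteq> 0" "cnj q = cnj (H a m) + ?l * cnj (H b m)" using den0[OF l] unfolding q_def by (metis complex_cnj_add complex_cnj_mult complex_cnj_zero complex_cnj_complex_of_real) simp
      have \<delta>q: "\<delta> ?l = - (1 + ?l^2) * N / (2 * cnj q)" unfolding \<delta>_def q0(2) by simp
      have c1: "H (a + ?l *s b) (a + ?l *s b) = (1 + ?l^2) * N"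
        unfolding hf_lin N_def ab by (simp add: field_simps power2_eq_square)
      have c2: "H (a + ?l *s b) m = q" unfolding hf_lin q_def by simp
      have c3: "H m (a + ?l *s b) = cnj q" using c2 hf_cnj by metis
      have "H (\<gamma> ?l) (\<gamma> ?l) = (1 + ?l^2) * N + cnj (\<delta> ?l) * q + \<delta> ?l * cnj q"
        unfolding \<gamma>_def hf_add_left[of c "a + ?l *s b"] hf_add_right[of c _ "a + ?l *s b"] hf_scale_left[of c "\<delta> ?l"] hf_scale_right[of c _ "\<delta> ?l"] c1 c2 c3 mm
        by (simp add: algebra_simps)
      also have "\<dots> = 0" unfolding \<delta>q using q0(1) Nr by (simp add: field_simps)
      finally show ?thesis .
    qed
    have "K (\<gamma> \<i>) (\<gamma> (cnj \<i>)) = 0"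
    proof (rule holomorphic_zero_from_reals[OF F])
      fix s :: real assume s: "\<bar>s\<bar> < 2"
      have "K (\<gamma> (of_real s)) (\<gamma> (of_real s)) = 0" using K_null[OF inD null[OF s]] s by simp
      then show "K (\<gamma> (of_real s)) (\<gamma> (cnj (of_real s))) = 0" by simp
    qed simp
    moreover have "\<gamma> \<i> = z" "\<gamma> (cnj \<i>) = w"
      unfolding \<gamma>_def \<delta>_def a_def b_def A_def B_def by (simp_all add: vec_eq_iff field_simps)
    ultimately show ?thesis by simp
  qed
  show ?thesis
  proof (intro exI[of _ "min \<rho> r0"] conjI ballI impI)
    show "min \<rho> r0 > 0" using \<rho> r0 by simp
    show "ball z0 (min \<rho> r0) \<subseteq> D" using r0 by auto
    fix z w assume "z \<in> ball z0 (min \<rho> r0)" "w \<in> ball z0 (min \<rho> r0)" "H z w = 0"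
    then show "K z w = 0" by (intro main Q \<rho>) (auto simp: dist_commute)
  qed
qed

end

subsection \<open>Images of null points\<close>

lemma sum_lessThan_add:
  fixes f :: "nat \<Rightarrow> 'a::comm_monoid_add"
  shows "(\<Sum>i<k + d. f i) = (\<Sum>i<k. f i) + (\<Sum>l<d. f (k + l))"
  by (induction d) (auto simp: add.assoc)

text \<open>Two coordinates of each sign leave room for a positive \<open>v\<close> and a negative
  \<open>w\<close> orthogonal to \<open>x\<close>. Since \<open>hflip\<close> fixes \<open>v\<close>
  and negates \<open>w\<close>, a suitably scaled sum \<open>u\<close> of the two is null and forms
  a hyperbolic pair with \<open>hflip c u\<close>.\<close>

lemma exists_null_companion:
  fixes c :: "'n::finite \<Rightarrow> real"
  assumes sgn: "\<And>j. c j \<in> {-1, 0, 1}" and p: "2 \<le> card {j. c j = 1}" and q: "2 \<le> card {j. c j = -1}"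
  shows "\<exists>u. hf c u u = 0 \<and> hf c u x = 0 \<and> hf c (hflip c u) x = 0 \<and> hf c u (hflip c u) = 1"
proof -
  obtain v where v: "v \<noteq> 0" "\<And>j. c j \<noteq> 1 \<Longrightarrow> v$j = 0" "hf c v x = 0"
  proof -
    have "\<exists>v. v \<noteq> 0 \<and> (\<forall>j. j \<notin> {j. c j = 1} \<longrightarrow> v $ j = 0) \<and> (\<forall>y\<in>{x}. hf c v y = 0)"
      by (rule exists_supported_orthogonal[where a = 1]) (use p in simp_all)
    then show ?thesis using that by blast
  qed
  obtain w where w: "w \<noteq> 0" "\<And>j. c j \<noteq> -1 \<Longrightarrow> w$j = 0" "hf c w x = 0"
  proof -
    have "\<exists>w. w \<noteq> 0 \<and> (\<forall>j. j \<notin> {j. c j = -1} \<longrightarrow> w $ j = 0) \<and> (\<forall>y\<in>{x}. hf c w y = 0)"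
      by (rule exists_supported_orthogonal[where a = "-1"]) (use q in simp_all)
    then show ?thesis using that by blast
  qed
  define \<alpha> where "\<alpha> = Re (hf c v v)"
  define \<beta> where "\<beta> = - Re (hf c w w)"
  have \<alpha>: "\<alpha> > 0" unfolding \<alpha>_def by (rule hf_supported_pos) (use v in blast)+
  have "Re (hf (\<lambda>j. - c j) w w) > 0" by (rule hf_supported_pos) (use w(1,2) in \<open>simp_all add: minus_equation_iff\<close>)
  then have \<beta>: "\<beta> > 0" unfolding \<beta>_def hf_uminus by simp
  have vv: "hf c v v = of_real \<alpha>" and ww: "hf c w w = - of_real \<beta>"
    unfolding \<alpha>_def \<beta>_def by (simp_all add: complex_eq_iff)
  have vw: "hf c v w = 0" unfolding hf_def using v(2) w(2) by (intro sum.neutral) force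
  then have wv: "hf c w v = 0" using hf_sym_0 by blast
  \<comment> \<open>The scaled vectors have squares 1/2 and -1/2; the sum of these is 0 and their
    difference is 1.\<close>
  define s where "s = (of_real (sqrt (1 / (2 * \<alpha>))) :: complex)"
  define t where "t = (of_real (sqrt (1 / (2 * \<beta>))) :: complex)"
  have sq: "sqrt (1 / (2 * a)) * sqrt (1 / (2 * a)) * a = 1 / 2" if "a > 0" for a :: real
    using that by simp
  have st: "s * s * of_real \<alpha> = 1/2" "t * t * of_real \<beta> = 1/2" "cnj s = s" "cnj t = t"
    unfolding s_def t_def of_real_mult[symmetric] sq[OF \<alpha>] sq[OF \<beta>] by simp_all
  have st': "s * (s * of_real \<alpha>) = 1/2" "t * (t * of_real \<beta>) = 1/2"
    using st by (simp_all add: mult.assoc)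
  define u where "u = s *s v + t *s w"
  have "hflip c v = v" "hflip c w = - w"
  proof -
    show "hflip c v = v" unfolding vec_eq_iff
    proof
      fix j show "hflip c v $ j = v $ j" using v(2)[of j] by (cases "c j = 1") (auto simp: hflip_def)
    qed
    show "hflip c w = - w" unfolding vec_eq_iff
    proof
      fix j show "hflip c w $ j = (- w) $ j" using w(2)[of j] by (cases "c j = -1") (auto simp: hflip_def)
    qed
  qed
  moreover have "hflip c u = s *s hflip c v + t *s hflip c w"
    unfolding u_def by (simp add: hflip_def vec_eq_iff algebra_simps)
  ultimately have Ju: "hflip c u = s *s v - t *s w" by (simp add: vec_eq_iff)
  have 1: "hf c u u = 0" and 2: "hf c u (hflip c u) = 1"
    unfolding Ju unfolding u_def hf_lin vv ww vw wv st(3,4) by (simp_all add: st' algebra_simps)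
  have 3: "hf c u x = 0" and 4: "hf c (hflip c u) x = 0"
    unfolding Ju unfolding u_def hf_lin v(3) w(3) by simp_all
  show ?thesis using 1 2 3 4 by blast
qed

text \<open>\<open>D\<close> has been shrunk so that orthogonality is preserved throughout. The
  equality of the indices enters as \<open>index_le\<close>.\<close>

locale orth_map = sign_map c c' g D
  for c :: "'n::finite \<Rightarrow> real" and c' :: "'m::finite \<Rightarrow> real" and g D +
  assumes pos_index: "2 \<le> card {j. c j = 1}" and neg_index: "2 \<le> card {j. c j = -1}"
    and index_le: "card {j. c' j = 1} \<le> card {j. c j = 1}"
    and orth: "\<And>x w. x \<in> D \<Longrightarrow> w \<in> D \<Longrightarrow> hf c x w = 0 \<Longrightarrow> hf c' (g x) (g w) = 0"
    and null_D: "\<exists>z\<in>D. hf c z z = 0"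
begin

abbreviation "dg x v \<equiv> frechet_derivative g (at x) v"

text \<open>As \<open>x\<close> belongs to \<open>N\<close> and is orthogonal to \<open>N\<close>,
  it is null and orthogonal to any family built over \<open>N\<close>. Adding \<open>x\<close> to
  small multiples of that family therefore moves it into \<open>D\<close> without changing signs or
  orthogonality.\<close>

lemma exists_positive_family_near:
  assumes x: "x \<in> D" "\<forall>v\<in>N. H x v = 0" "x \<in> N" and N: "finite N" "k + card N \<le> card {j. c j = 1}"
  shows "\<exists>C::nat \<Rightarrow> complex^'n. (\<forall>i<k. C i \<in> D \<and> Re (H (C i) (C i)) > 0) \<and> (\<forall>i<k. \<forall>v\<in>N. H (C i) v = 0)
     \<and> (\<forall>i<k. \<forall>j<k. i \<noteq> j \<longrightarrow> H (C i) (C j) = 0)"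
proof -
  obtain a :: "nat \<Rightarrow> complex^'n" where a: "\<And>i. i < k \<Longrightarrow> Re (H (a i) (a i)) > 0"
     "\<And>i v. i < k \<Longrightarrow> v \<in> N \<Longrightarrow> H (a i) v = 0" "\<And>i j. i < k \<Longrightarrow> j < k \<Longrightarrow> i \<noteq> j \<Longrightarrow> H (a i) (a j) = 0"
    using exists_orthogonal_positive_family[OF N] by blast
  have "eventually (\<lambda>e::real. x + of_real e *s a i \<in> D) (at_right 0)" for i
  proof (rule eventually_D)
    have "((\<lambda>e::real. x + of_real e *s a i) \<longlongrightarrow> x + of_real 0 *s a i) (at_right 0)"
      by (intro tendsto_intros)
    then show "((\<lambda>e::real. x + of_real e *s a i) \<longlongrightarrow> x) (at_right 0)" by simp
  qed (fact x)
  then have "eventually (\<lambda>e::real. \<forall>i\<in>{..<k}. x + of_real e *s a i \<in> D) (at_right 0)"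
    by (intro eventually_ball_finite) auto
  then have "eventually (\<lambda>e::real. (\<forall>i\<in>{..<k}. x + of_real e *s a i \<in> D) \<and> e > 0) (at_right 0)"
    by (rule eventually_conj) (simp add: eventually_at_filter)
  then obtain e :: real where e: "\<And>i. i < k \<Longrightarrow> x + of_real e *s a i \<in> D" "e > 0"
    using eventually_happens'[OF trivial_limit_at_right_real] by (metis (no_types, lifting) lessThan_iff)
  have xa: "H x (a i) = 0" "H (a i) x = 0" if "i < k" for i using a(2)[OF that x(3)] hf_sym_0 by blast+
  show ?thesis
  proof (intro exI[of _ "\<lambda>i. x + of_real e *s a i"] conjI allI impI ballI)
    fix i assume i: "i < k"
    show "x + of_real e *s a i \<in> D" using e i by blast
    have "H (x + of_real e *s a i) (x + of_real e *s a i) = of_real (e * e) * H (a i) (a i)"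
      unfolding hf_lin xa[OF i] using x(2,3) by simp
    then show "Re (H (x + of_real e *s a i) (x + of_real e *s a i)) > 0" using a(1)[OF i] e(2) by simp
  next
    fix i v assume "i < k" "v \<in> N"
    then show "H (x + of_real e *s a i) v = 0" unfolding hf_lin using a(2) x(2) by simp
  next
    fix i j assume "i < k" "j < k" "i \<noteq> j"
    then show "H (x + of_real e *s a i) (x + of_real e *s a j) = 0" unfolding hf_lin using a(3) xa x(2,3) by simp
  qed
qed

text \<open>Completing the images of \<open>card {c = 1} - card N\<close> orthogonal positive points to an orthogonal family,
  there is no room for more than \<open>card N\<close> independent null vectors.\<close>

lemma null_family_dependent:
  assumes x: "x \<in> D" "\<forall>v\<in>N. H x v = 0" "x \<in> N"
    and N: "finite N" "card N \<le> card {j. c j = 1}" "card N < d"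
    and X: "\<And>l j. l < d \<Longrightarrow> c' j = 0 \<Longrightarrow> X l $ j = 0"
      "\<And>l l'. l < d \<Longrightarrow> l' < d \<Longrightarrow> hf c' (X l) (X l') = 0"
      "\<And>l w. l < d \<Longrightarrow> w \<in> D \<Longrightarrow> (\<And>v. v \<in> N \<Longrightarrow> H w v = 0) \<Longrightarrow> hf c' (X l) (g w) = 0"
  shows "\<exists>b. (\<exists>l<d. b l \<noteq> 0) \<and> (\<Sum>l<d. b l *s X l) = 0"
proof -
  \<comment> \<open>Since \<open>card N < d\<close>, the \<open>k\<close> positive images and the
    \<open>d\<close> vectors \<open>X l\<close> together outnumber the positive coordinates of the
    target.\<close>
  define k where "k = card {j. c j = 1} - card N"
  have k: "k + card N \<le> card {j. c j = 1}" "card {j. c' j = 1} < k + d"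
    using N index_le unfolding k_def by auto
  obtain C :: "nat \<Rightarrow> complex^'n" where C0: "\<forall>i<k. C i \<in> D \<and> Re (H (C i) (C i)) > 0"
     "\<forall>i<k. \<forall>v\<in>N. H (C i) v = 0" "\<forall>i<k. \<forall>j<k. i \<noteq> j \<longrightarrow> H (C i) (C j) = 0"
    using exists_positive_family_near[OF x N(1) k(1)] by (elim exE conjE) (rule that)
  have C: "\<And>i. i < k \<Longrightarrow> C i \<in> D" "\<And>i. i < k \<Longrightarrow> Re (H (C i) (C i)) > 0"
     "\<And>i v. i < k \<Longrightarrow> v \<in> N \<Longrightarrow> H (C i) v = 0"
     "\<And>i j. i < k \<Longrightarrow> j < k \<Longrightarrow> i \<noteq> j \<Longrightarrow> H (C i) (C j) = 0"
    using C0 by simp_all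
  define Y where "Y = (\<lambda>i. if i < k then g (C i) else X (i - k))"
  have XC: "hf c' (X l) (g (C i)) = 0" "hf c' (g (C i)) (X l) = 0" if "i < k" "l < d" for i l
  proof -
    show "hf c' (X l) (g (C i)) = 0" by (rule X(3)) (use that C in auto)
    then show "hf c' (g (C i)) (X l) = 0" using hf_sym_0 by blast
  qed
  have "\<exists>b. (\<exists>i<k + d. b i \<noteq> 0) \<and> (\<Sum>i<k + d. b i *s Y i) = 0 \<and> (\<forall>i<k + d. Re (hf c' (Y i) (Y i)) > 0 \<longrightarrow> b i = 0)"
  proof (rule orthogonal_family_dependent[OF sgn' k(2)])
    fix i j assume "i < k + d" "j < k + d" "i \<noteq> j"
    then show "hf c' (Y i) (Y j) = 0"
      unfolding Y_def using XC X(2) orth[OF C(1) C(1) C(4)] by auto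
  next
    fix i assume "i < k + d"
    then show "0 \<le> Re (hf c' (Y i) (Y i))"
      unfolding Y_def using X(2)[of "i - k" "i - k"] pos[OF C(1) C(2)] by (auto intro: less_imp_le)
  next
    fix i j assume "i < k + d" "c' j = 0"
    then show "Y i $ j = 0" unfolding Y_def using X(1)[of "i - k" j] trunc C(1) by auto
  qed
  then obtain b where b: "\<exists>i<k + d. b i \<noteq> 0" "(\<Sum>i<k + d. b i *s Y i) = 0"
     "\<And>i. i < k + d \<Longrightarrow> Re (hf c' (Y i) (Y i)) > 0 \<Longrightarrow> b i = 0" by blast
  have b0: "b i = 0" if "i < k" for i
    using b(3)[of i] that pos[OF C(1) C(2)] unfolding Y_def by simp
  have "(\<Sum>l<d. b (k + l) *s X l) = 0"
    using b(2) unfolding sum_lessThan_add by (simp add: b0 Y_def)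
  moreover obtain i where i: "i < k + d" "b i \<noteq> 0" using b(1) by blast
  then have "\<not> i < k" using b0 by blast
  then have "i - k < d" "b (k + (i - k)) \<noteq> 0" using i by auto
  ultimately show ?thesis by (intro exI[of _ "\<lambda>l. b (k + l)"]) blast
qed

text \<open>The images of \<open>x\<close>, \<open>y\<close>, \<open>z\<close> are null, mutually
  orthogonal, and orthogonal to the image of every point orthogonal to \<open>x\<close> and
  \<open>y\<close>. Two conditions and three vectors: this is the collinearity of images of null
  lines.\<close>

lemma null_plane_dependent:
  assumes "x \<in> D" "y \<in> D" "z \<in> D" "H x x = 0" "H x y = 0" "H y y = 0" "z = \<alpha> *s x + \<beta> *s y"
  shows "\<exists>b1 b2 b3. (b1 \<noteq> 0 \<or> b2 \<noteq> 0 \<or> b3 \<noteq> 0) \<and> b1 *s g x + b2 *s g y + b3 *s g z = 0"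
proof -
  define X where "X = (\<lambda>l::nat. if l = 0 then x else if l = 1 then y else z)"
  have yx: "H y x = 0" using assms hf_sym_0 by blast
  have XD: "X l \<in> D" for l using assms by (auto simp: X_def)
  have XX: "H (X l) (X l') = 0" for l l'
    unfolding X_def assms(7) by (auto simp: hf_lin assms(4-6) yx)
  have "\<exists>b. (\<exists>l<3::nat. b l \<noteq> 0) \<and> (\<Sum>l<3. b l *s g (X l)) = 0"
  proof (rule null_family_dependent[of x "{x, y}"])
    show "card {x, y} \<le> card {j. c j = 1}" "card {x, y} < 3"
      using card_insert_le_m1[of 2 "{y}" x] pos_index by auto
    fix l w assume "w \<in> D" "\<And>v. v \<in> {x, y} \<Longrightarrow> H w v = 0"
    then have "H w (X l) = 0" unfolding X_def assms(7) by (auto simp: hf_lin)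
    then show "K (X l) w = 0" using orth XD \<open>w \<in> D\<close> hf_sym_0 by blast
  qed (use assms XX XD orth trunc in auto)
  then obtain b where b: "\<exists>l<3::nat. b l \<noteq> 0" "(\<Sum>l<3. b l *s g (X l)) = 0" by blast
  have "b 0 *s g x + b 1 *s g y + b 2 *s g z = 0"
    using b(2) by (simp add: eval_nat_numeral X_def)
  moreover have "b 0 \<noteq> 0 \<or> b 1 \<noteq> 0 \<or> b 2 \<noteq> 0"
    using b(1) by (auto simp: eval_nat_numeral less_Suc_eq)
  ultimately show ?thesis by blast
qed

text \<open>A criterion for being a multiple of \<open>g x\<close>: the count with
  \<open>N = {x}\<close> leaves no room for two independent null vectors orthogonal to the images of
  all points orthogonal to \<open>x\<close>.\<close>

lemma null_vector_dependent:
  assumes "x \<in> D" "H x x = 0" "\<And>j. c' j = 0 \<Longrightarrow> T $ j = 0" "hf c' T T = 0"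
    "\<And>w. w \<in> D \<Longrightarrow> H x w = 0 \<Longrightarrow> hf c' T (g w) = 0"
  shows "\<exists>a b. (a \<noteq> 0 \<or> b \<noteq> 0) \<and> a *s g x + b *s T = 0"
proof -
  define X where "X = (\<lambda>l::nat. if l = 0 then g x else T)"
  have TX: "hf c' T (g x) = 0" using assms by blast
  have "\<exists>b. (\<exists>l<2::nat. b l \<noteq> 0) \<and> (\<Sum>l<2. b l *s X l) = 0"
  proof (rule null_family_dependent[of x "{x}"])
    fix l l' :: nat show "hf c' (X l) (X l') = 0"
      unfolding X_def using TX hf_sym_0[of c' T "g x"] orth assms by auto
  next
    fix l :: nat and w assume w: "w \<in> D" "\<And>v. v \<in> {x} \<Longrightarrow> H w v = 0"
    then have "H x w = 0" using hf_sym_0 by blast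
    then show "hf c' (X l) (g w) = 0" unfolding X_def using assms orth w(1) by auto
  qed (use assms pos_index trunc in \<open>auto simp: X_def\<close>)
  then obtain b where b: "\<exists>l<2::nat. b l \<noteq> 0" "(\<Sum>l<2. b l *s X l) = 0" by blast
  have "b 0 *s g x + b 1 *s T = 0" using b(2) by (simp add: eval_nat_numeral X_def)
  moreover have "b 0 \<noteq> 0 \<or> b 1 \<noteq> 0" using b(1) by (auto simp: eval_nat_numeral less_Suc_eq)
  ultimately show ?thesis by blast
qed

text \<open>Otherwise \<open>K\<close> vanishes at the null points of the complex line through a
  null \<open>z0\<close> in direction \<open>J z0\<close>, hence on that line near
  \<open>z0\<close>. But the line contains a positive \<open>w\<close>, for which
  \<open>K w w\<close> is not 0.\<close>

lemma exists_null_not_orthogonal: "\<exists>x\<in>D. H x x = 0 \<and> (\<exists>w\<in>D. K x w \<noteq> 0)"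
proof (rule ccontr)
  assume "\<not> ?thesis"
  then have z: "\<And>x w. x \<in> D \<Longrightarrow> H x x = 0 \<Longrightarrow> w \<in> D \<Longrightarrow> K x w = 0" by blast
  obtain z0 where z0: "z0 \<in> D" "H z0 z0 = 0" using null_D by blast
  obtain r where r: "r > 0" "ball z0 r \<subseteq> D" using open_D z0 open_contains_ball by blast
  define \<rho> where "\<rho> = r / (norm (J z0) + 1)"
  have n: "norm (J z0) + 1 > 0" using norm_ge_zero[of "J z0"] by linarith
  have \<rho>: "\<rho> > 0" "\<rho> * norm (J z0) < r" using r n by (simp_all add: \<rho>_def pos_divide_less_eq algebra_simps)
  have inD: "z0 + t *s J z0 \<in> D" if "t \<in> ball 0 \<rho>" for t
  proof -
    have "norm (t *s J z0) \<le> \<rho> * norm (J z0)" unfolding norm_vec_scale using that by (intro mult_right_mono) auto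
    then show ?thesis using r \<rho> by (auto simp: dist_norm)
  qed
  define w where "w = z0 + of_real (\<rho> / 2) *s J z0"
  have wD: "w \<in> D" unfolding w_def by (rule inD) (use \<rho> in auto)
  have "Re (H w w) > 0" unfolding w_def H_flip_line[OF z0(2)] using \<rho> nonrad[OF z0(1)] by simp
  then have "K w w \<noteq> 0" using pos[OF wD] by auto
  \<comment> \<open>The parameter is rotated by \<i> so that the null points of the line have real
    parameters; the value used here returns to \<open>w\<close>.\<close>
  moreover have "K (z0 + (\<i> * (- \<i> * of_real (\<rho> / 2))) *s J z0) w = 0"
  proof (rule holomorphic_zero_from_reals[of "\<lambda>t. K (z0 + (\<i> * t) *s J z0) w" \<rho>])
    show "(\<lambda>t. K (z0 + (\<i> * t) *s J z0) w) holomorphic_on ball 0 \<rho>"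
      by (rule holomorphic_hf_curve[OF holo]) (auto intro!: hol_curve_intros holomorphic_intros inD simp: norm_mult)
    fix s :: real assume s: "\<bar>s\<bar> < \<rho>"
    show "K (z0 + (\<i> * of_real s) *s J z0) w = 0"
      by (rule z[OF inD _ wD]) (use s in \<open>auto simp: H_flip_line[OF z0(2)] norm_mult\<close>)
  qed (use \<rho> in \<open>auto simp: norm_mult norm_divide\<close>)
  ultimately show False unfolding w_def by simp
qed

lemma dg_trunc:
  assumes "x \<in> D" "c' j = 0"
  shows "dg x v $ j = 0"
proof -
  have T: "open {t. x + t *s v \<in> D}" "0 \<in> {t. x + t *s v \<in> D}" using open_line_preimage[OF open_D] assms by auto
  have "((\<lambda>t. 0) has_field_derivative dg x v $ j) (at 0)"
    by (rule has_field_derivative_transform_within_open[OF line_derivative[OF holo assms(1)] T])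
      (use trunc assms in auto)
  then show ?thesis using DERIV_unique DERIV_const by blast
qed

lemma dg_zero:
  assumes "x \<in> D" "\<And>t. x + t *s v \<in> D \<Longrightarrow> hf c' (g (x + t *s v)) T = 0"
  shows "hf c' (dg x v) T = 0"
proof -
  have T: "open {t. x + t *s v \<in> D}" "0 \<in> {t. x + t *s v \<in> D}" using open_line_preimage[OF open_D] assms by auto
  have "((\<lambda>t. 0) has_field_derivative hf c' (dg x v) T) (at 0)"
    by (rule has_field_derivative_transform_within_open[OF line_derivative_hf[OF holo assms(1)] T])
      (use assms in auto)
  then show ?thesis using DERIV_unique DERIV_const by blast
qed

lemma dg_orth:
  assumes "x \<in> D" "w \<in> D" "H x w = 0" "H v w = 0"
  shows "hf c' (dg x v) (g w) = 0"
  using assms by (intro dg_zero orth) (auto simp: hf_lin)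

end

subsection \<open>Images of lines\<close>

context orth_map
begin

text \<open>If no such pair exists, then at each point \<open>X t\<close> of a null line the
  derivative along \<open>u\<close> meets the criterion for being a multiple of
  \<open>g (X t)\<close>. So \<open>g\<close> is projectively constant along the line, and
  \<open>K x1 w\<close> vanishes for each \<open>w\<close> orthogonal to some \<open>X t\<close>.
  These \<open>w\<close> contain an open set, so \<open>K x1\<close> vanishes on \<open>D\<close>,
  against the choice of \<open>x1\<close>.\<close>

lemma exists_simple_pair:
  "\<exists>x u w n1 n2. x \<in> D \<and> w \<in> D \<and> H x x = 0 \<and> H u u = 0 \<and> H x u = 0 \<and> H x w = 0 \<and> hf c' (dg x u) (g w) \<noteq> 0
     \<and> (\<exists>w'\<in>D. K x w' \<noteq> 0)
     \<and> H n1 n1 = 0 \<and> H n2 n2 = 0 \<and> H n1 n2 = 0 \<and> H x n1 = 1 \<and> H u n1 = 0 \<and> H x n2 = 0 \<and> H u n2 = 1"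
proof -
  obtain x1 w2 where x1: "x1 \<in> D" "H x1 x1 = 0" "w2 \<in> D" "K x1 w2 \<noteq> 0"
    using exists_null_not_orthogonal by blast
  obtain u where u: "H u u = 0" "H u x1 = 0" "H (J u) x1 = 0" "H u (J u) = 1"
    using exists_null_companion[OF sgn pos_index neg_index, of x1] by blast
  have u': "H x1 u = 0" "H x1 (J u) = 0" "H u (J x1) = 0" using u hf_sym_0 hflip_commute by metis+
  define E where "E = H x1 (J x1)"
  have E: "E \<noteq> 0" using nonrad[OF x1(1)] unfolding E_def by auto
  have Er: "cnj E = E" unfolding E_def hf_hflip_self by simp
  have JJ: "H (J u) (J u) = 0" "H (J x1) (J x1) = 0" "H (J x1) (J u) = 0"
    unfolding hf_hflip_hflip[OF sgn] using u u' x1 by auto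
  have ev: "eventually (\<lambda>t. x1 + t *s u \<in> D \<and> K (x1 + t *s u) w2 \<noteq> 0) (nhds 0)"
  proof -
    have "((\<lambda>t. x1 + t *s u) \<longlongrightarrow> x1 + 0 *s u) (nhds 0)" by (intro tendsto_intros filterlim_ident)
    then have l: "((\<lambda>t. x1 + t *s u) \<longlongrightarrow> x1) (nhds 0)" by simp
    have "((\<lambda>t. K (x1 + t *s u) w2) \<longlongrightarrow> K x1 w2) (nhds 0)"
      by (intro tendsto_intros l x1)
    then show ?thesis using eventually_D[OF l x1(1)] tendsto_imp_eventually_ne x1(4) by (intro eventually_conj) auto
  qed
  then obtain r where r: "r > 0" "\<And>t. dist t 0 < r \<Longrightarrow> x1 + t *s u \<in> D \<and> K (x1 + t *s u) w2 \<noteq> 0"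
    unfolding eventually_nhds_metric by blast
  define X where "X = (\<lambda>t. x1 + t *s u)"
  have X: "X t \<in> D" "K (X t) w2 \<noteq> 0" if "t \<in> ball 0 r" for t using r(2)[of t] that unfolding X_def by (auto simp: dist_commute)
  have Xn: "H (X t) (X s) = 0" "H (X t) u = 0" "H u (X t) = 0" for t s unfolding X_def by (auto simp: hf_lin u u' x1)
  have "\<exists>t\<in>ball 0 r. \<exists>w\<in>D. H (X t) w = 0 \<and> hf c' (dg (X t) u) (g w) \<noteq> 0"
  proof (rule ccontr)
    assume "\<not> ?thesis"
    then have crit: "hf c' (dg (X t) u) (g w) = 0" if "t \<in> ball 0 r" "w \<in> D" "H (X t) w = 0" for t w using that by blast
    have par: "\<exists>\<zeta>. dg (X t) u = \<zeta> *s g (X t)" if t: "t \<in> ball 0 r" for t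
    proof -
      have "hf c' (dg (X t) u) (dg (X t) u) = 0"
      proof (rule dg_zero[OF X(1)[OF t]])
        fix s assume "X t + s *s u \<in> D"
        then have "hf c' (dg (X t) u) (g (X t + s *s u)) = 0"
          by (intro dg_orth X t) (auto simp: hf_lin Xn u)
        then show "hf c' (g (X t + s *s u)) (dg (X t) u) = 0" using hf_sym_0 by blast
      qed
      then have "\<exists>a b. (a \<noteq> 0 \<or> b \<noteq> 0) \<and> a *s g (X t) + b *s dg (X t) u = 0"
        by (intro null_vector_dependent X t Xn dg_trunc crit)
      then obtain a b where ab: "a \<noteq> 0 \<or> b \<noteq> 0" "a *s g (X t) + b *s dg (X t) u = 0" by blast
      have "g (X t) \<noteq> 0" using X(2)[OF t] by auto
      then have b: "b \<noteq> 0" using ab by auto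
      have "dg (X t) u = (- a / b) *s g (X t)"
      proof -
        have "b *s dg (X t) u = - a *s g (X t)" using ab(2) by (simp add: eq_neg_iff_add_eq_0 add.commute)
        then have "(1 / b) *s (b *s dg (X t) u) = (1 / b) *s (- a *s g (X t))" by simp
        then show ?thesis using b by (simp add: vector_smult_assoc)
      qed
      then show ?thesis by blast
    qed
    have const: "\<exists>k. \<forall>t\<in>ball 0 r. K (X t) w = k * K (X t) w2" if w: "w \<in> D" for w
    proof -
      have d: "((\<lambda>t. K (X t) v) has_field_derivative hf c' (dg (X t) u) (g v)) (at t)" if t: "t \<in> ball 0 r" for t v
      proof -
        have "((\<lambda>s. hf c' (g (X t + (s - t) *s u)) (g v)) has_field_derivative hf c' (dg (X t) u) (g v)) (at t)"
          using line_derivative_hf[OF holo X(1)[OF t], of c' u "g v"] DERIV_shift[of "\<lambda>s. hf c' (g (X t + (s - t) *s u)) (g v)" "hf c' (dg (X t) u) (g v)" 0 t]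
          by simp
        moreover have "X t + (s - t) *s u = X s" for s unfolding X_def by (simp add: vec_eq_iff algebra_simps)
        ultimately show ?thesis by simp
      qed
      have "\<exists>k. \<forall>t\<in>ball 0 r. K (X t) w / K (X t) w2 = k"
      proof (rule has_field_derivative_zero_constant)
        fix t :: complex assume t: "t \<in> ball 0 r"
        obtain \<zeta> where \<zeta>: "dg (X t) u = \<zeta> *s g (X t)" using par[OF t] by blast
        have "((\<lambda>t. K (X t) w / K (X t) w2) has_field_derivative 0) (at t)"
          by (rule derivative_eq_intros d[OF t] refl X[OF t])+ (simp add: \<zeta> hf_lin)
        then show "((\<lambda>t. K (X t) w / K (X t) w2) has_field_derivative 0) (at t within ball 0 r)"
          by (rule has_field_derivative_at_within)
      qed simp
      then show ?thesis using X(2) by (metis nonzero_eq_divide_eq)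
    qed
    \<comment> \<open>The constant ratio of \<open>K (X t) w\<close> to \<open>K (X t) w2\<close> is
      0 because it is 0 at the point orthogonal to \<open>w\<close>; it can then be read off at
      \<open>x1\<close>.\<close>
    have zero: "K x1 w = 0" if w: "w \<in> D" and t: "t \<in> ball 0 r" and o: "H (X t) w = 0" for w t
    proof -
      obtain k where k: "\<And>t. t \<in> ball 0 r \<Longrightarrow> K (X t) w = k * K (X t) w2" using const[OF w] by blast
      have "K (X t) w = 0" by (rule orth[OF X(1)[OF t] w o])
      then have "k = 0" using k[OF t] X(2)[OF t] by simp
      then have "K (X 0) w = 0" using k[of 0] r(1) by simp
      then show ?thesis by (simp add: X_def)
    qed
    have "eventually (\<lambda>e. x1 + e *s J u \<in> D) (nhds 0)"
    proof (rule eventually_D[OF _ x1(1)])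
      have "((\<lambda>t. x1 + t *s J u) \<longlongrightarrow> x1 + 0 *s J u) (nhds 0)" by (intro tendsto_intros filterlim_ident)
      then show "((\<lambda>t. x1 + t *s J u) \<longlongrightarrow> x1) (nhds 0)" by simp
    qed
    then obtain e0 where e0: "e0 > 0" "\<And>t. dist t 0 < e0 \<Longrightarrow> x1 + t *s J u \<in> D" unfolding eventually_nhds_metric by blast
    define e where "e = (of_real (e0 / 2) :: complex)"
    \<comment> \<open>\<open>w1\<close> is orthogonal to \<open>x1\<close> but not to
      \<open>u\<close>. For \<open>w\<close> close to \<open>w1\<close> the equation
      \<open>H (X t) w = 0\<close> thus has a solution \<open>t\<close> close to 0.\<close>
    define w1 where "w1 = x1 + e *s J u"
    have w1: "w1 \<in> D" unfolding w1_def by (rule e0) (use e0(1) in \<open>simp add: e_def\<close>)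
    have "H x1 w1 = 0" "H u w1 \<noteq> 0" unfolding w1_def hf_lin x1 u u' using e0(1) by (simp_all add: e_def)
    have lim: "((\<lambda>w. - H x1 w / H u w) \<longlongrightarrow> - H x1 w1 / H u w1) (nhds w1)"
      by (intro tendsto_intros filterlim_ident) fact
    have "eventually (\<lambda>w. - H x1 w / H u w \<in> ball 0 r) (nhds w1)"
      using topological_tendstoD[OF lim open_ball, of 0 r] \<open>H x1 w1 = 0\<close> r(1) by simp
    moreover have "eventually (\<lambda>w. H u w \<noteq> 0) (nhds w1)"
      by (rule tendsto_imp_eventually_ne[of _ "H u w1"]) (intro tendsto_intros filterlim_ident, fact)
    moreover have "eventually (\<lambda>w. w \<in> D) (nhds w1)" using eventually_nhds_in_open[OF open_D w1] .
    ultimately have "eventually (\<lambda>w. w \<in> D \<and> K x1 w = 0) (nhds w1)"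
    proof eventually_elim
      case (elim w)
      have "H (X (- H x1 w / H u w)) w = 0" using elim by (simp add: X_def hf_lin)
      then show ?case using zero elim by blast
    qed
    then obtain U where U: "open U" "w1 \<in> U" "\<forall>w\<in>U. w \<in> D \<and> K x1 w = 0" unfolding eventually_nhds by blast
    have "hf c' (g w2) (g x1) = 0"
      by (rule line_hol_zero[OF line_hol_hf[OF holo open_D] open_D convex_D U(1)]) (use U x1 hf_sym_0 in blast)+
    then show False using x1(4) hf_sym_0 by blast
  qed
  then obtain t w where t: "t \<in> ball 0 r" and w: "w \<in> D" "H (X t) w = 0" "hf c' (dg (X t) u) (g w) \<noteq> 0" by blast
  \<comment> \<open>\<open>J x1\<close> and \<open>J u\<close>, normalised to be dual to
    \<open>X t\<close> and \<open>u\<close>; the term \<open>cnj t *s n1\<close> cancels the pairing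
    \<open>t\<close> of \<open>X t\<close> with \<open>J u\<close>.\<close>
  define n1 where "n1 = (1 / E) *s J x1"
  define n2 where "n2 = J u - cnj t *s n1"
  have n: "H n1 n1 = 0" "H n2 n2 = 0" "H n1 n2 = 0" 
    unfolding n2_def hf_lin unfolding n1_def hf_lin using JJ hf_sym_0[of c "J x1" "J u"] by simp_all
  have n': "H (X t) n1 = 1" "H u n1 = 0" "H (X t) n2 = 0" "H u n2 = 1"
    unfolding n2_def X_def hf_lin unfolding n1_def hf_lin using E Er u u' by (simp_all add: E_def[symmetric])
  show ?thesis using X[OF t] x1(3) w Xn u(1) n n' by blast
qed

end

text \<open>The coefficients of a linear dependence need not vary holomorphically with the points,
  but the determinant of the pairings does, so collinearity is recorded as its vanishing.\<close>

lemma det3_zero: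
  fixes b1 :: complex
  assumes "b1 * a11 + b2 * a21 + b3 * a31 = 0" "b1 * a12 + b2 * a22 + b3 * a32 = 0" "b1 * a13 + b2 * a23 + b3 * a33 = 0"
    and "b1 \<noteq> 0 \<or> b2 \<noteq> 0 \<or> b3 \<noteq> 0"
  shows "a11 * (a22 * a33 - a23 * a32) - a12 * (a21 * a33 - a23 * a31) + a13 * (a21 * a32 - a22 * a31) = 0" (is "?d = 0")
proof -
  have "b1 * ?d = 0" "b2 * ?d = 0" "b3 * ?d = 0" using assms(1-3) by algebra+
  then show ?thesis using assms(4) by auto
qed

text \<open>\<open>simple\<close> says that \<open>K x w0\<close>, which vanishes at
  \<open>x0\<close>, has a nonzero derivative there in the direction \<open>u\<close>. The vectors
  \<open>n1\<close>, \<open>n2\<close> span a null plane dual to the plane of \<open>x0\<close> and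
  \<open>u\<close>.\<close>

locale simple_pair = orth_map c c' g D
  for c :: "'n::finite \<Rightarrow> real" and c' :: "'m::finite \<Rightarrow> real" and g D +
  fixes x0 u w0 n1 n2 :: "complex^'n"
  assumes x0_D: "x0 \<in> D" and w0_D: "w0 \<in> D" and x0_null: "hf c x0 x0 = 0" and u_null: "hf c u u = 0"
    and x0_u: "hf c x0 u = 0" and x0_w0: "hf c x0 w0 = 0"
    and simple: "hf c' (frechet_derivative g (at x0) u) (g w0) \<noteq> 0"
    and x0_nonorth: "\<exists>w\<in>D. hf c' (g x0) (g w) \<noteq> 0"
    and n1_n1: "hf c n1 n1 = 0" and n2_n2: "hf c n2 n2 = 0" and n1_n2: "hf c n1 n2 = 0"
    and x0_n1: "hf c x0 n1 = 1" and u_n1: "hf c u n1 = 0" and x0_n2: "hf c x0 n2 = 0" and u_n2: "hf c u n2 = 1"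
begin

lemma u_x0: "H u x0 = 0" using x0_u hf_sym_0 by blast

lemma n2_u: "H n2 u = 1" using u_n2 hf_cnj[of c u n2] by simp

lemma n2_n1: "H n2 n1 = 0" using n1_n2 hf_sym_0 by blast

lemma u_w0: "H u w0 \<noteq> 0"
  using simple dg_orth[OF x0_D w0_D x0_w0] by blast

text \<open>A line close to the null line through \<open>x0\<close> and \<open>u\<close> with basis \<open>b1\<close>, \<open>b2\<close> dual to \<open>n1\<close>, \<open>n2\<close>
  moves in the holomorphic family of the lines consisting of the
  \<open>v + (\<mu> - 1)/2 (\<langle>v, b1\<rangle> n1 + \<langle>v, b2\<rangle> n2)\<close>, on which the form is \<open>Re \<mu>\<close> times
  the original one; hence it is null for imaginary \<open>\<mu>\<close>.\<close>

lemma lines_to_lines: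
  assumes \<eta>: "\<eta> \<noteq> 0" and xs: "xs = x0 + \<eta> *s u" "xs \<in> D"
  shows "\<exists>\<delta>>0. ball x0 \<delta> \<subseteq> D \<and> ball xs \<delta> \<subseteq> D \<and>
    (\<forall>y\<in>ball x0 \<delta>. \<forall>x\<in>ball xs \<delta>. \<forall>t::real. 0 \<le> t \<longrightarrow> t \<le> 1 \<longrightarrow> (\<forall>v1\<in>D. \<forall>v2\<in>D. \<forall>v3\<in>D.
      (let z = y + of_real t *s (x - y) in
       K y v1 * (K x v2 * K z v3 - K x v3 * K z v2) - K y v2 * (K x v1 * K z v3 - K x v3 * K z v1)
       + K y v3 * (K x v1 * K z v2 - K x v2 * K z v1) = 0)))"
proof -
  obtain r1 r2 where r12: "r1 > 0" "ball x0 r1 \<subseteq> D" "r2 > 0" "ball xs r2 \<subseteq> D" using open_D x0_D xs open_contains_ball by metis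
  define r where "r = min r1 r2"
  have r: "r > 0" "ball x0 r \<subseteq> D" "ball xs r \<subseteq> D" using r12 unfolding r_def by auto
  \<comment> \<open>The determinant of the pairings of \<open>y\<close>, \<open>x\<close> with
    \<open>n1\<close>, \<open>n2\<close>; Cramer's rule yields the dual basis \<open>b1\<close>,
    \<open>b2\<close> below.\<close>
  define Dt where "Dt = (\<lambda>y x. H y n1 * H x n2 - H y n2 * H x n1)"
  define b1 where "b1 = (\<lambda>y x. (1 / Dt y x) *s (H x n2 *s y - H y n2 *s x))"
  define b2 where "b2 = (\<lambda>y x. (1 / Dt y x) *s (H y n1 *s x - H x n1 *s y))"
  define e where "e = (\<lambda>y x v. H v (b1 y x) *s n1 + H v (b2 y x) *s n2)"
  \<comment> \<open>As |\<kappa>| is at most 3/2 on the disc used below, the bound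
    \<open>r/3\<close> on the corrections costs at most \<open>r/2\<close>, and the moved points
    remain within \<open>r\<close> of \<open>x0\<close> and \<open>xs\<close>.\<close>
  define P where "P = (\<lambda>y x. Dt y x \<noteq> 0 \<and> norm (y - x0) < r / 2 \<and> norm (x - xs) < r / 2 \<and> norm (e y x y) < r / 3 \<and> norm (e y x x) < r / 3)"
  have xsn: "H xs n1 = 1" "H xs n2 = \<eta>" unfolding xs hf_lin x0_n1 u_n1 x0_n2 u_n2 by simp_all
  have Dt0: "Dt x0 xs = \<eta>" unfolding Dt_def xsn x0_n1 x0_n2 by simp
  have b10: "b1 x0 xs = x0" "b2 x0 xs = u" unfolding b1_def b2_def Dt0 xsn x0_n1 x0_n2 using \<eta>
    by (simp_all add: vector_smult_assoc) (simp add: xs vector_smult_assoc)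
  have e0: "e x0 xs x0 = 0" "e x0 xs xs = 0" unfolding e_def b10 unfolding xs hf_lin x0_null x0_u u_x0 u_null by simp_all
  let ?F = "nhds x0 \<times>\<^sub>F nhds xs"
  have f: "(fst \<longlongrightarrow> x0) ?F" "(snd \<longlongrightarrow> xs) ?F" by (rule filterlim_fst filterlim_snd)+
  have tD: "((\<lambda>p. Dt (fst p) (snd p)) \<longlongrightarrow> Dt x0 xs) ?F" unfolding Dt_def by (intro tendsto_intros f)
  have Dtn: "Dt x0 xs \<noteq> 0" using Dt0 \<eta> by simp
  have tb: "((\<lambda>p. b1 (fst p) (snd p)) \<longlongrightarrow> b1 x0 xs) ?F" "((\<lambda>p. b2 (fst p) (snd p)) \<longlongrightarrow> b2 x0 xs) ?F"
    unfolding b1_def b2_def by (intro tendsto_intros f tD Dtn)+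
  have te: "((\<lambda>p. e (fst p) (snd p) (fst p)) \<longlongrightarrow> e x0 xs x0) ?F" "((\<lambda>p. e (fst p) (snd p) (snd p)) \<longlongrightarrow> e x0 xs xs) ?F"
    unfolding e_def by (intro tendsto_intros f tb)+
  have "((\<lambda>p. norm (fst p - x0)) \<longlongrightarrow> norm (x0 - x0)) ?F" "((\<lambda>p. norm (snd p - xs)) \<longlongrightarrow> norm (xs - xs)) ?F"
    "((\<lambda>p. norm (e (fst p) (snd p) (fst p))) \<longlongrightarrow> norm (e x0 xs x0)) ?F" "((\<lambda>p. norm (e (fst p) (snd p) (snd p))) \<longlongrightarrow> norm (e x0 xs xs)) ?F"
    by (intro tendsto_intros f te)+
  then have "eventually (\<lambda>p. P (fst p) (snd p)) ?F"
    unfolding P_def e0 using r(1) tendsto_imp_eventually_ne[OF tD Dtn]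
    by (intro eventually_conj order_tendstoD(2)) auto
  then obtain Q1 Q2 where Q: "eventually Q1 (nhds x0)" "eventually Q2 (nhds xs)" "\<And>y x. Q1 y \<Longrightarrow> Q2 x \<Longrightarrow> P y x"
    unfolding eventually_prod_filter by auto
  obtain d1 where d1: "d1 > 0" "\<And>y. dist y x0 < d1 \<Longrightarrow> Q1 y" using Q(1) unfolding eventually_nhds_metric by blast
  obtain d2 where d2: "d2 > 0" "\<And>y. dist y xs < d2 \<Longrightarrow> Q2 y" using Q(2) unfolding eventually_nhds_metric by blast
  have main: "K y v1 * (K x v2 * K z v3 - K x v3 * K z v2) - K y v2 * (K x v1 * K z v3 - K x v3 * K z v1)
       + K y v3 * (K x v1 * K z v2 - K x v2 * K z v1) = 0"
    if P: "P y x" and t: "0 \<le> t" "t \<le> 1" and v: "v1 \<in> D" "v2 \<in> D" "v3 \<in> D" and z: "z = y + of_real t *s (x - y)" for y x v1 v2 v3 z and t :: real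
  proof -
    \<comment> \<open>This is (\<mu> - 1)/2 with \<mu> = -\<i> l: real \<open>l\<close> give null
      lines, and \<open>l = \<i>\<close> gives \<kappa> = 0, the original line.\<close>
    define \<kappa> where "\<kappa> = (\<lambda>l. (- \<i> * l - 1) / 2)"
    define C where "C = (\<lambda>v l. v + \<kappa> l *s e y x v)"
    define Z where "Z = (\<lambda>l. C y l + of_real t *s (C x l - C y l))"
    have P': "Dt y x \<noteq> 0" "norm (y - x0) < r / 2" "norm (x - xs) < r / 2" "norm (e y x y) < r / 3" "norm (e y x x) < r / 3"
      using P unfolding P_def by auto
    have \<kappa>: "norm (\<kappa> l) \<le> 3 / 2" if "l \<in> ball 0 2" for l
    proof -
      have "norm (- \<i> * l - 1) \<le> norm (- \<i> * l) + norm (1::complex)" by (rule norm_triangle_ineq4)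
      also have "\<dots> \<le> 2 + 1" using that by (simp add: norm_mult)
      finally show ?thesis unfolding \<kappa>_def norm_divide by simp
    qed
    have near: "C v l \<in> D" if l: "l \<in> ball 0 2" and v: "norm (v - a) < r / 2" "norm (e y x v) < r / 3" "ball a r \<subseteq> D" for v a l
    proof -
      have "norm (C v l - a) = norm ((v - a) + \<kappa> l *s e y x v)" unfolding C_def by (simp add: algebra_simps)
      also have "\<dots> \<le> norm (v - a) + norm (\<kappa> l *s e y x v)" by (rule norm_triangle_ineq)
      also have "norm (\<kappa> l *s e y x v) \<le> 3 / 2 * (r / 3)" unfolding norm_vec_scale using v(2) \<kappa>[OF l] by (intro mult_mono) auto
      finally have "norm (C v l - a) < r" using v(1) by simp
      then show ?thesis using v(3) by (auto simp: dist_norm norm_minus_commute)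
    qed
    have Cy: "C y l \<in> D" and Cx: "C x l \<in> D" if "l \<in> ball 0 2" for l using near that P' r by blast+
    have Zc: "Z l = of_real (1 - t) *s C y l + of_real t *s C x l" for l unfolding Z_def by (simp add: vec_eq_iff algebra_simps)
    have CZ: "Z l \<in> D" if "l \<in> ball 0 2" for l
    proof -
      have "(1 - t) *\<^sub>R C y l + t *\<^sub>R C x l \<in> D" using convexD_alt[OF convex_D Cy[OF that] Cx[OF that] t] .
      then show ?thesis unfolding Zc by (simp add: vec_eq_iff scaleR_conv_of_real vector_scalar_mult_def scaleR_vec_def)
    qed
    have basis: "v = H v n1 *s b1 y x + H v n2 *s b2 y x" if "v = y \<or> v = x" for v
    proof -
      have c1: "H v n1 * H x n2 - H v n2 * H x n1 = (if v = y then Dt y x else 0)" 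
        and c2: "H v n2 * H y n1 - H v n1 * H y n2 = (if v = y then 0 else Dt y x)" if "v = y \<or> (v = x \<and> x \<noteq> y)" for v
        using that unfolding Dt_def by (auto simp: algebra_simps)
      have "H v n1 *s b1 y x + H v n2 *s b2 y x = ((H v n1 * H x n2 - H v n2 * H x n1) / Dt y x) *s y + ((H v n2 * H y n1 - H v n1 * H y n2) / Dt y x) *s x"
        unfolding b1_def b2_def by (simp add: vec_eq_iff algebra_simps diff_divide_distrib)
      also have "\<dots> = v" using P'(1) that c1[of v] c2[of v] by (cases "v = y") auto
      finally show ?thesis by simp
    qed
    \<comment> \<open>The coefficients in \<open>e\<close> are pairings with the basis dual to
      \<open>n1\<close>, \<open>n2\<close>, so \<open>e y x v'\<close> pairs with the vectors of the
      plane exactly as \<open>v'\<close> does, while all the vectors \<open>e y x v\<close> are null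
      and mutually orthogonal.\<close>
    have He: "H v (e y x v') = H v v'" if "v = y \<or> v = x" "v' = y \<or> v' = x" for v v'
    proof -
      have "H v v' = H v n1 * H (b1 y x) v' + H v n2 * H (b2 y x) v'"
        by (subst basis[OF that(1)]) (simp add: hf_lin)
      also have "\<dots> = H v (e y x v')" unfolding e_def hf_lin hf_cnj by simp
      finally show ?thesis by simp
    qed
    have He': "H (e y x v) v' = H v v'" if "v = y \<or> v = x" "v' = y \<or> v' = x" for v v'
      using He[OF that(2,1)] hf_cnj by metis
    have ee: "H (e y x v) (e y x v') = 0" for v v' unfolding e_def hf_lin n1_n1 n2_n2 n1_n2 n2_n1 by simp
    have null: "H (C v (of_real s)) (C v' (of_real s)) = 0" if "v = y \<or> v = x" "v' = y \<or> v' = x" for v v' and s :: real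
    proof -
      have "H (C v (of_real s)) (C v' (of_real s)) = (1 + \<kappa> (of_real s) + cnj (\<kappa> (of_real s))) * H v v'"
        unfolding C_def hf_lin He[OF that] He'[OF that] ee by (simp add: algebra_simps)
      also have "1 + \<kappa> (of_real s) + cnj (\<kappa> (of_real s)) = 0" unfolding \<kappa>_def by (simp add: complex_eq_iff)
      finally show ?thesis by simp
    qed
    define F where "F = (\<lambda>l. K (C y l) v1 * (K (C x l) v2 * K (Z l) v3 - K (C x l) v3 * K (Z l) v2)
       - K (C y l) v2 * (K (C x l) v1 * K (Z l) v3 - K (C x l) v3 * K (Z l) v1)
       + K (C y l) v3 * (K (C x l) v1 * K (Z l) v2 - K (C x l) v2 * K (Z l) v1))"
    have \<kappa>h: "\<kappa> holomorphic_on ball 0 2" unfolding \<kappa>_def by (intro holomorphic_intros) auto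
    have cC: "hol_curve (ball 0 2) (C v)" for v unfolding C_def by (intro hol_curve_intros \<kappa>h open_ball)
    have cZ: "hol_curve (ball 0 2) Z"
    proof -
      have "Z = (\<lambda>l. z + \<kappa> l *s (e y x y + of_real t *s (e y x x - e y x y)))"
        unfolding Z_def C_def z by (rule ext) (simp add: vec_eq_iff algebra_simps)
      then show ?thesis by (simp only:) (intro hol_curve_intros \<kappa>h open_ball)
    qed
    have Fh: "F holomorphic_on ball 0 2"
      unfolding F_def
      by (intro holomorphic_intros holomorphic_hf_curve[OF holo cC Cy] holomorphic_hf_curve[OF holo cC Cx] holomorphic_hf_curve[OF holo cZ CZ])
    have "F \<i> = 0"
    proof (rule holomorphic_zero_from_reals[OF Fh])
      fix s :: real assume "\<bar>s\<bar> < 2"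
      then have l: "of_real s \<in> ball (0::complex) 2" by simp
      obtain k1 k2 k3 where k: "k1 \<noteq> 0 \<or> k2 \<noteq> 0 \<or> k3 \<noteq> 0"
        "k1 *s g (C y (of_real s)) + k2 *s g (C x (of_real s)) + k3 *s g (Z (of_real s)) = 0"
        using null_plane_dependent[OF Cy[OF l] Cx[OF l] CZ[OF l] null null null Zc] by blast
      have "k1 * K (C y (of_real s)) v + k2 * K (C x (of_real s)) v + k3 * K (Z (of_real s)) v = 0" for v
        using arg_cong[OF k(2), of "\<lambda>T. hf c' T (g v)"] by (simp add: hf_lin)
      then show "F (of_real s) = 0" unfolding F_def using k(1) by (intro det3_zero)
    qed simp
    moreover have "\<kappa> \<i> = 0" unfolding \<kappa>_def by simp
    ultimately show ?thesis unfolding F_def Z_def C_def z by simp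
  qed
  show ?thesis
  proof (intro exI[of _ "Min {d1, d2, r}"] conjI ballI allI impI)
    show "0 < Min {d1, d2, r}" using d1 d2 r by simp
    show "ball x0 (Min {d1, d2, r}) \<subseteq> D" "ball xs (Min {d1, d2, r}) \<subseteq> D" using r by auto
    fix y x v1 v2 v3 and t :: real
    assume "y \<in> ball x0 (Min {d1, d2, r})" "x \<in> ball xs (Min {d1, d2, r})" "0 \<le> t" "t \<le> 1" "v1 \<in> D" "v2 \<in> D" "v3 \<in> D"
    then show "let z = y + of_real t *s (x - y) in
       K y v1 * (K x v2 * K z v3 - K x v3 * K z v2) - K y v2 * (K x v1 * K z v3 - K x v3 * K z v1)
       + K y v3 * (K x v1 * K z v2 - K x v2 * K z v1) = 0"
      unfolding Let_def by (intro main Q d1 d2) (auto simp: dist_commute)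
  qed
qed

end

subsection \<open>Proportionality of the two Hermitian kernels\<close>

lemma derivative_zero_from_reals:
  assumes "(\<phi> has_field_derivative d) (at (0::complex))" "\<And>t::real. 0 \<le> t \<Longrightarrow> t \<le> 1 \<Longrightarrow> \<phi> (of_real t) = 0"
  shows "d = 0"
proof -
  have "((\<lambda>h. (\<phi> (0 + h) - \<phi> 0) / h) \<longlongrightarrow> d) (at 0)"
    using assms(1) by (simp add: has_field_derivative_iff)
  moreover have "filterlim (of_real :: real \<Rightarrow> complex) (at 0) (at_right 0)"
    unfolding filterlim_at
  proof
    show "eventually (\<lambda>x::real. complex_of_real x \<in> UNIV \<and> complex_of_real x \<noteq> 0) (at_right 0)"
      by (simp add: eventually_at_filter)
    show "((of_real :: real \<Rightarrow> complex) \<longlongrightarrow> 0) (at_right 0)"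
      using tendsto_of_real[OF tendsto_ident_at, of 0 "{0<..}"] by simp
  qed
  ultimately have "((\<lambda>t::real. (\<phi> (0 + of_real t) - \<phi> 0) / of_real t) \<longlongrightarrow> d) (at_right 0)"
    by (rule filterlim_compose)
  moreover have "eventually (\<lambda>t::real. t \<in> {0<..<1}) (at_right 0)"
    by (rule eventually_at_right_real) simp
  then have "eventually (\<lambda>t::real. (\<phi> (0 + of_real t) - \<phi> 0) / of_real t = 0) (at_right 0)"
    by (rule eventually_mono) (use assms(2)[of 0] assms(2) in auto)
  ultimately have "((\<lambda>t::real. 0) \<longlongrightarrow> d) (at_right (0::real))"
    by (rule Lim_transform_eventually)
  then show ?thesis by (metis tendsto_const tendsto_unique trivial_limit_at_right_real)
qed

lemma parallel_imp_scale:
  fixes a b :: "complex^'n"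
  assumes "\<And>i j. a $ i * b $ j = a $ j * b $ i" "a \<noteq> 0"
  shows "\<exists>k. b = k *s a"
proof -
  obtain i where i: "a $ i \<noteq> 0" using assms(2) by (auto simp: vec_eq_iff)
  have "b $ j = b $ i / a $ i * a $ j" for j
  proof -
    have "b $ j * a $ i = b $ i * a $ j" using assms(1)[of i j] by (simp only: mult.commute)
    then show ?thesis unfolding times_divide_eq_left nonzero_eq_divide_eq[OF i] .
  qed
  then have "b = (b $ i / a $ i) *s a" unfolding vec_eq_iff vector_smult_component by blast
  then show ?thesis by blast
qed

context simple_pair
begin

abbreviation "S y w \<equiv> hf c' (dg y u) (g w)"

text \<open>The direction \<open>H u w *s v - H v w *s u\<close> is orthogonal to \<open>w\<close>,
  so the derivative along it is orthogonal to \<open>g w\<close>.\<close>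

lemma dg_ratio:
  assumes "y \<in> D" "w \<in> D" "H y w = 0"
  shows "H u w * hf c' (dg y v) (g w) = H v w * S y w"
proof -
  have "hf c' (dg y (H u w *s v + (- H v w) *s u)) (g w) = 0"
    by (rule dg_orth) (use assms in \<open>simp_all add: hf_lin\<close>)
  then show ?thesis
    unfolding frechet_derivative_add[OF holo assms(1)] cholo_on_frechet(2)[OF holo assms(1)] hf_lin by simp
qed

text \<open>Because \<open>K y w\<close> and \<open>K y w'\<close> vanish, the determinant reduces
  to a 2x2 minor. Its derivative at \<open>y\<close> towards \<open>x\<close> is rewritten by
  \<open>dg_ratio\<close>. Read as quotients, the result says that \<open>K x w / H x w\<close> and
  \<open>K x w' / H x w'\<close> differ by a factor that does not depend on
  \<open>x\<close>.\<close>

lemma simple_zero_relation: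
  assumes y: "y \<in> D" and w: "w \<in> D" "w' \<in> D" and yw: "H y w = 0" "H y w' = 0"
    and v: "v \<in> D" "K y v \<noteq> 0"
    and rel: "\<And>t::real. 0 \<le> t \<Longrightarrow> t \<le> 1 \<Longrightarrow> (let z = y + of_real t *s (x - y) in
       K y v * (K x w * K z w' - K x w' * K z w) - K y w * (K x v * K z w' - K x w' * K z v)
       + K y w' * (K x v * K z w - K x w * K z v) = 0)"
  shows "H x w * S y w * H u w' * K x w' = H x w' * S y w' * H u w * K x w"
proof -
  define \<phi> where "\<phi> = (\<lambda>t. K x w * K (y + t *s (x - y)) w' - K x w' * K (y + t *s (x - y)) w)"
  have "(\<phi> has_field_derivative (K x w * hf c' (dg y (x - y)) (g w') - K x w' * hf c' (dg y (x - y)) (g w))) (at 0)"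
    unfolding \<phi>_def by (intro DERIV_diff DERIV_cmult line_derivative_hf[OF holo y])
  then have "K x w * hf c' (dg y (x - y)) (g w') - K x w' * hf c' (dg y (x - y)) (g w) = 0"
  proof (rule derivative_zero_from_reals)
    fix t :: real assume "0 \<le> t" "t \<le> 1"
    from rel[OF this] show "\<phi> (of_real t) = 0"
      unfolding Let_def \<phi>_def orth[OF y w(1) yw(1)] orth[OF y w(2) yw(2)] using v(2) by simp
  qed
  then have e: "K x w * hf c' (dg y (x - y)) (g w') = K x w' * hf c' (dg y (x - y)) (g w)" by simp
  have r: "H u w * hf c' (dg y (x - y)) (g w) = H x w * S y w" "H u w' * hf c' (dg y (x - y)) (g w') = H x w' * S y w'"
    using dg_ratio[OF y w(1) yw(1), of "x - y"] dg_ratio[OF y w(2) yw(2), of "x - y"] yw by (simp_all add: hf_lin)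
  show ?thesis using e r by algebra
qed

text \<open>The quotient \<open>K x w / \<langle>x, w\<rangle>\<close> is compared for \<open>w\<close> and \<open>w0\<close> along the chain \<open>w\<close>, \<open>w''\<close>, \<open>w0\<close>,
  where \<open>w\<close>, \<open>w''\<close> are both orthogonal to a point \<open>y\<close> and \<open>w''\<close>, \<open>w0\<close> both to \<open>x0\<close>.\<close>

lemma kernel_ratio:
  assumes \<eta>: "\<eta> \<noteq> 0" and xs: "xs = x0 + \<eta> *s u" "xs \<in> D"
  shows "\<exists>\<delta>>0. \<exists>\<delta>'>0. ball w0 \<delta> \<subseteq> D \<and> ball xs \<delta>' \<subseteq> D \<and>
    (\<forall>w\<in>ball w0 \<delta>. \<exists>\<gamma>. \<gamma> \<noteq> 0 \<and> (\<forall>x\<in>ball xs \<delta>'. K x w * H x w0 = \<gamma> * K x w0 * H x w))"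
proof -
  obtain \<delta>' where \<delta>': "\<delta>' > 0" "ball x0 \<delta>' \<subseteq> D" "ball xs \<delta>' \<subseteq> D"
    and LL: "\<And>y x t v1 v2 v3. y \<in> ball x0 \<delta>' \<Longrightarrow> x \<in> ball xs \<delta>' \<Longrightarrow> 0 \<le> t \<Longrightarrow> t \<le> 1 \<Longrightarrow> v1 \<in> D \<Longrightarrow> v2 \<in> D \<Longrightarrow> v3 \<in> D \<Longrightarrow>
      (let z = y + of_real (t::real) *s (x - y) in
       K y v1 * (K x v2 * K z v3 - K x v3 * K z v2) - K y v2 * (K x v1 * K z v3 - K x v3 * K z v1)
       + K y v3 * (K x v1 * K z v2 - K x v2 * K z v1) = 0)"
    using lines_to_lines[OF \<eta> xs] by (elim exE conjE) (rule that, blast+)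
  obtain w1 where w1: "w1 \<in> D" "K x0 w1 \<noteq> 0" using x0_nonorth by blast
  have i: "((\<lambda>y. y) \<longlongrightarrow> x0) (nhds x0)" "((\<lambda>y. y) \<longlongrightarrow> w0) (nhds w0)" by (rule filterlim_ident)+
  have "((\<lambda>y. K y w1) \<longlongrightarrow> K x0 w1) (nhds x0)" by (intro tendsto_intros i x0_D)
  then have e1: "eventually (\<lambda>y. K y w1 \<noteq> 0) (nhds x0)" using w1(2) by (rule tendsto_imp_eventually_ne)
  let ?F = "nhds x0 \<times>\<^sub>F nhds w0"
  have "((\<lambda>p. S (fst p) (snd p)) \<longlongrightarrow> S x0 w0) ?F"
    by (intro tendsto_hf tendsto_g filterlim_snd w0_D
        filterlim_compose[OF tendsto_frechet_derivative[OF holo open_D x0_D] filterlim_fst])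
  then have "eventually (\<lambda>p. S (fst p) (snd p) \<noteq> 0) ?F" using simple by (rule tendsto_imp_eventually_ne)
  then obtain Q1 Q2 where Q: "eventually Q1 (nhds x0)" "eventually Q2 (nhds w0)" "\<And>y w. Q1 y \<Longrightarrow> Q2 w \<Longrightarrow> S y w \<noteq> 0"
    unfolding eventually_prod_filter by auto
  have "((\<lambda>w. H u w) \<longlongrightarrow> H u w0) (nhds w0)" by (intro tendsto_intros i)
  then have e2: "eventually (\<lambda>w. H u w \<noteq> 0) (nhds w0)" using u_w0 by (rule tendsto_imp_eventually_ne)
  have "eventually (\<lambda>y. Q1 y \<and> K y w1 \<noteq> 0 \<and> y \<in> ball x0 \<delta>') (nhds x0)"
    using Q(1) e1 eventually_nhds_in_open[OF open_ball, of x0 x0 \<delta>'] \<delta>'(1) by (intro eventually_conj) auto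
  then obtain \<delta>1 where \<delta>1: "\<delta>1 > 0" "\<And>y. dist y x0 < \<delta>1 \<Longrightarrow> Q1 y \<and> K y w1 \<noteq> 0 \<and> y \<in> ball x0 \<delta>'"
    unfolding eventually_nhds_metric by blast
  have ew: "eventually (\<lambda>w. Q2 w \<and> H u w \<noteq> 0 \<and> w \<in> D) (nhds w0)"
    using Q(2) e2 eventually_nhds_in_open[OF open_D w0_D] by (intro eventually_conj)
  \<comment> \<open>\<open>q\<close> is \<open>n2\<close> made orthogonal to \<open>w0\<close>.
    Moving \<open>x0\<close> by a small multiple of \<open>q\<close> keeps it orthogonal to
    \<open>w0\<close> but gives it a nonzero pairing with \<open>u\<close>, which \<open>x0\<close>
    itself does not have.\<close>
  define q where "q = n2 - (H n2 w0 / H u w0) *s u"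
  have q: "H q u = 1" "H q w0 = 0" unfolding q_def using u_w0 by (simp_all add: hf_lin n2_u u_null)
  define \<epsilon> where "\<epsilon> = complex_of_real (\<delta>1 / (2 * (norm q + 1)))"
  have nq: "norm q + 1 > 0" using norm_ge_zero[of q] by linarith
  have \<epsilon>: "\<epsilon> \<noteq> 0" "norm (\<epsilon> *s q) < \<delta>1"
  proof -
    show "\<epsilon> \<noteq> 0" unfolding \<epsilon>_def of_real_eq_0_iff using \<delta>1(1) nq by simp
    have "norm (\<epsilon> *s q) = \<delta>1 / (2 * (norm q + 1)) * norm q"
      unfolding norm_vec_scale \<epsilon>_def norm_of_real using \<delta>1 nq by simp
    also have "\<dots> < \<delta>1"
    proof -
      have "\<delta>1 * norm q < \<delta>1 * (2 * (norm q + 1))" by (rule mult_strict_left_mono) (use \<delta>1 nq in auto)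
      then show ?thesis using nq by (simp add: pos_divide_less_eq)
    qed
    finally show "norm (\<epsilon> *s q) < \<delta>1" .
  qed
  \<comment> \<open>Corrected along \<open>u\<close> to be orthogonal to \<open>w\<close>; the
    pairing with \<open>u\<close> remains \<epsilon>, since \<open>u\<close> is null.\<close>
  define Y where "Y = (\<lambda>w. x0 + \<epsilon> *s q - (H (x0 + \<epsilon> *s q) w / H u w) *s u)"
  \<comment> \<open>The intermediate point of the chain: a correction along \<open>u\<close> makes
    it orthogonal to \<open>Y w\<close>, which is possible since
    \<open>H (Y w) u = \<epsilon>\<close> is nonzero, and keeps it orthogonal to
    \<open>x0\<close>.\<close>
  define W where "W = (\<lambda>w. w0 - cnj (H (Y w) w0 / H (Y w) u) *s u)"
  have Yu: "H (Y w) u = \<epsilon>" for w unfolding Y_def hf_lin x0_u q u_null by simp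
  have xq0: "H (x0 + \<epsilon> *s q) w0 = 0" unfolding hf_lin x0_w0 q by simp
  have "(Y \<longlongrightarrow> x0 + \<epsilon> *s q - (H (x0 + \<epsilon> *s q) w0 / H u w0) *s u) (nhds w0)"
    unfolding Y_def by (intro tendsto_intros i u_w0)
  then have tY: "(Y \<longlongrightarrow> x0 + \<epsilon> *s q) (nhds w0)" unfolding xq0 by simp
  have "(W \<longlongrightarrow> w0 - cnj (H (x0 + \<epsilon> *s q) w0 / \<epsilon>) *s u) (nhds w0)"
    unfolding W_def Yu by (intro tendsto_intros i \<epsilon> tY)
  then have tW: "(W \<longlongrightarrow> w0) (nhds w0)" unfolding xq0 by simp
  have eY: "eventually (\<lambda>w. Y w \<in> ball x0 \<delta>1) (nhds w0)"
    using \<epsilon>(2) by (intro topological_tendstoD[OF tY open_ball]) (simp add: dist_norm)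
  have eW: "eventually (\<lambda>w. Q2 (W w) \<and> H u (W w) \<noteq> 0 \<and> W w \<in> D) (nhds w0)"
    using tW ew by (rule eventually_compose_filterlim[rotated])
  have "eventually (\<lambda>w. (Q2 w \<and> H u w \<noteq> 0 \<and> w \<in> D) \<and> Y w \<in> ball x0 \<delta>1 \<and> (Q2 (W w) \<and> H u (W w) \<noteq> 0 \<and> W w \<in> D)) (nhds w0)"
    by (intro eventually_conj ew eY eW)
  then obtain \<delta> where \<delta>: "\<delta> > 0" "\<And>w. dist w w0 < \<delta> \<Longrightarrow> (Q2 w \<and> H u w \<noteq> 0 \<and> w \<in> D) \<and> Y w \<in> ball x0 \<delta>1 \<and> (Q2 (W w) \<and> H u (W w) \<noteq> 0 \<and> W w \<in> D)"
    unfolding eventually_nhds_metric by blast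
  have "\<exists>\<gamma>. \<gamma> \<noteq> 0 \<and> (\<forall>x\<in>ball xs \<delta>'. K x w * H x w0 = \<gamma> * K x w0 * H x w)" if "w \<in> ball w0 \<delta>" for w
  proof -
    have w: "Q2 w" "H u w \<noteq> 0" "w \<in> D" "dist (Y w) x0 < \<delta>1" "Q2 (W w)" "H u (W w) \<noteq> 0" "W w \<in> D"
      using \<delta>(2)[of w] that by (auto simp: dist_commute)
    have Yw: "Q1 (Y w)" "K (Y w) w1 \<noteq> 0" "Y w \<in> ball x0 \<delta>'" using \<delta>1(2)[OF w(4)] by auto
    have x0': "Q1 x0" "x0 \<in> ball x0 \<delta>'" "Q2 w0" using \<delta>1(2)[of x0] \<delta>1(1) \<delta>'(1) eventually_nhds_x_imp_x[OF Q(2)] by auto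
    have YD: "Y w \<in> D" using Yw(3) \<delta>'(2) by blast
    have o: "H (Y w) w = 0" "H (Y w) (W w) = 0" "H x0 (W w) = 0"
    proof -
      show "H (Y w) w = 0" unfolding Y_def hf_diff_left[of c "x0 + \<epsilon> *s q"] hf_scale_left[of c _ u] using w(2) by simp
      show "H (Y w) (W w) = 0" unfolding W_def hf_diff_right hf_scale_right using \<epsilon>(1) Yu[of w] by simp
      show "H x0 (W w) = 0" unfolding W_def hf_diff_right hf_scale_right x0_w0 x0_u by simp
    qed
    define a where "a = S (Y w) w * H u (W w)"
    define b where "b = S (Y w) (W w) * H u w"
    define a' where "a' = S x0 (W w) * H u w0"
    define b' where "b' = S x0 w0 * H u (W w)"
    have nz: "a \<noteq> 0" "b \<noteq> 0" "a' \<noteq> 0" "b' \<noteq> 0"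
      unfolding a_def b_def a'_def b'_def using Q(3) Yw x0' w u_w0 by auto
    \<comment> \<open>Combining the two relations of the chain gives \<psi> = 0 only after
      multiplication by \<open>H x (W w)\<close>. This factor is nonzero on a nonempty open set,
      from which the identity theorem extends \<psi> = 0.\<close>
    define \<psi> where "\<psi> = (\<lambda>x. b * b' * (hf c' (g x) (g w) * H x w0) - a * a' * (hf c' (g x) (g w0) * H x w))"
    have prod: "H x (W w) * \<psi> x = 0" if x: "x \<in> ball xs \<delta>'" for x
    proof -
      have "H x w * S (Y w) w * H u (W w) * K x (W w) = H x (W w) * S (Y w) (W w) * H u w * K x w"
        by (rule simple_zero_relation[OF YD w(3,7) o(1,2) w1(1) Yw(2)]) (rule LL[OF Yw(3) x _ _ w1(1) w(3,7)])
      moreover have "H x (W w) * S x0 (W w) * H u w0 * K x w0 = H x w0 * S x0 w0 * H u (W w) * K x (W w)"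
        by (rule simple_zero_relation[OF x0_D w(7) w0_D o(3) x0_w0 w1]) (rule LL[OF x0'(2) x _ _ w1(1) w(7) w0_D])
      ultimately show ?thesis unfolding \<psi>_def a_def b_def a'_def b'_def by algebra
    qed
    have hb: "cholo_on (ball xs \<delta>') g" using cholo_on_subset[OF holo \<delta>'(3)] .
    have lc: "line_hol B (\<lambda>x. k)" for B and k :: complex unfolding line_hol_def by simp
    have lh: "line_hol (ball xs \<delta>') \<psi>" unfolding \<psi>_def
      by (intro line_hol_diff line_hol_mult lc line_hol_hf[OF hb open_ball] line_hol_hf_id)
    define U where "U = ball xs \<delta>' \<inter> {x. H x (W w) \<noteq> 0}"
    have U: "open U" "U \<subseteq> ball xs \<delta>'" unfolding U_def
      by (auto intro!: open_Int open_Collect_neq continuous_intros)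
    have "U \<noteq> {}"
    proof
      assume "U = {}"
      then have z: "H x (W w) = 0" if "x \<in> ball xs \<delta>'" for x using that unfolding U_def by auto
      have "H u (W w) = 0"
      proof -
        define s where "s = complex_of_real (\<delta>' / (2 * (norm u + 1)))"
        have nu: "norm u + 1 > 0" using norm_ge_zero[of u] by linarith
        have "norm (s *s u) = \<delta>' / (2 * (norm u + 1)) * norm u"
          unfolding norm_vec_scale s_def norm_of_real using \<delta>' nu by simp
        also have "\<dots> < \<delta>'"
        proof -
          have "\<delta>' * norm u < \<delta>' * (2 * (norm u + 1))" by (rule mult_strict_left_mono) (use \<delta>' nu in auto)
          then show ?thesis using nu by (simp add: pos_divide_less_eq)
        qed
        finally have "H (xs + s *s u) (W w) = 0" by (intro z) (simp add: dist_norm)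
        moreover have "H xs (W w) = 0" using z \<delta>' by simp
        moreover have "s \<noteq> 0" unfolding s_def of_real_eq_0_iff using \<delta>'(1) nu by simp
        ultimately show ?thesis by (simp add: hf_lin)
      qed
      then show False using w(6) by blast
    qed
    then have "\<psi> x = 0" if "x \<in> ball xs \<delta>'" for x
      using line_hol_zero[OF lh open_ball convex_ball U] prod that unfolding U_def by force
    then have "K x w * H x w0 = (a * a' / (b * b')) * K x w0 * H x w" if "x \<in> ball xs \<delta>'" for x
      using that nz unfolding \<psi>_def by (simp add: field_simps)
    then show ?thesis using nz by (intro exI[of _ "a * a' / (b * b')"]) auto
  qed
  moreover have "ball w0 \<delta> \<subseteq> D" using \<delta>(2) by (auto simp: dist_commute)
  ultimately show ?thesis using \<delta>(1) \<delta>'(1,3) by blast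
qed

end

subsection \<open>The isometry near a null point\<close>

context simple_pair
begin

text \<open>Such a \<open>T\<close> depends linearly on \<open>g x0\<close> by the criterion for
  null vectors, yet \<open>g x0\<close> is not orthogonal to all images.\<close>

lemma orthogonal_to_all_zero:
  assumes "\<And>j. c' j = 0 \<Longrightarrow> T $ j = 0" "hf c' T T = 0" "\<And>w. w \<in> D \<Longrightarrow> hf c' T (g w) = 0"
  shows "T = 0"
proof -
  obtain a b where ab: "a \<noteq> 0 \<or> b \<noteq> 0" "a *s g x0 + b *s T = 0"
    using null_vector_dependent[OF x0_D x0_null assms] by blast
  obtain w where w: "w \<in> D" "K x0 w \<noteq> 0" using x0_nonorth by blast
  have "hf c' (a *s g x0 + b *s T) (g w) = 0" unfolding ab(2) by simp
  then have "a = 0" using assms(3)[OF w(1)] w(2) by (simp add: hf_lin)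
  then show ?thesis using ab by simp
qed

text \<open>After division by the factor depending on \<open>x\<close>, the vector
  \<open>G x\<close> satisfies \<open>\<langle>G x, g w\<rangle> = \<gamma> w \<langle>x,
  w\<rangle>\<close>, a condition linear in \<open>x\<close> and \<open>G x\<close>. It defines a
  linear relation that is single valued, because a vector orthogonal to all images is zero, and
  total, because a ball spans. Its matrix \<open>M\<close> has to be shown conformal with a positive
  factor.\<close>

lemma exists_isometry:
  "\<exists>M::complex^'n^'m. (\<forall>p q. hf c' (M *v p) (M *v q) = H p q) \<and> (\<forall>p j. c' j = 0 \<longrightarrow> (M *v p) $ j = 0) \<and>
     (\<forall>x\<in>D. \<forall>i j. g x $ i * (M *v x) $ j = g x $ j * (M *v x) $ i)"
proof -
  \<comment> \<open>A nonzero derivative along \<open>u\<close> forces a point on the null line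
    whose image is not orthogonal to \<open>g w0\<close>.\<close>
  obtain \<eta> where \<eta>D: "x0 + \<eta> *s u \<in> D" and \<eta>K: "K (x0 + \<eta> *s u) w0 \<noteq> 0"
    using dg_zero[OF x0_D, of u "g w0"] simple by blast
  have \<eta>0: "\<eta> \<noteq> 0" using \<eta>K orth[OF x0_D w0_D x0_w0] by auto
  define xs where "xs = x0 + \<eta> *s u"
  have xs: "xs \<in> D" "K xs w0 \<noteq> 0" "H xs w0 \<noteq> 0" "H xs xs = 0"
    unfolding xs_def hf_lin x0_w0 x0_null x0_u u_null u_x0 using \<eta>D \<eta>K u_w0 \<eta>0 by simp_all
  obtain \<delta> \<delta>' where \<delta>: "\<delta> > 0" "\<delta>' > 0" "ball w0 \<delta> \<subseteq> D" "ball xs \<delta>' \<subseteq> D"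
    and R: "\<forall>w\<in>ball w0 \<delta>. \<exists>\<gamma>. \<gamma> \<noteq> 0 \<and> (\<forall>x\<in>ball xs \<delta>'. K x w * H x w0 = \<gamma> * K x w0 * H x w)"
    using kernel_ratio[OF \<eta>0 xs_def xs(1)] by blast
  obtain \<gamma> where \<gamma>: "\<And>w. w \<in> ball w0 \<delta> \<Longrightarrow> \<gamma> w \<noteq> 0"
    "\<And>w x. w \<in> ball w0 \<delta> \<Longrightarrow> x \<in> ball xs \<delta>' \<Longrightarrow> K x w * H x w0 = \<gamma> w * K x w0 * H x w"
    using bchoice[OF R] by blast
  have i: "((\<lambda>y. y) \<longlongrightarrow> xs) (nhds xs)" by (rule filterlim_ident)
  have t: "((\<lambda>x. K x w0) \<longlongrightarrow> K xs w0) (nhds xs)" "((\<lambda>x. H x w0) \<longlongrightarrow> H xs w0) (nhds xs)"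
    by (intro tendsto_intros i xs)+
  have "eventually (\<lambda>x. x \<in> ball xs \<delta>') (nhds xs)" using \<delta>(2) by (intro eventually_nhds_in_open) auto
  then have "eventually (\<lambda>x. K x w0 \<noteq> 0 \<and> H x w0 \<noteq> 0 \<and> x \<in> ball xs \<delta>') (nhds xs)"
    by (intro eventually_conj tendsto_imp_eventually_ne[OF t(1) xs(2)] tendsto_imp_eventually_ne[OF t(2) xs(3)])
  then obtain \<rho> where \<rho>: "\<rho> > 0" "\<And>x. x \<in> ball xs \<rho> \<Longrightarrow> K x w0 \<noteq> 0 \<and> H x w0 \<noteq> 0 \<and> x \<in> ball xs \<delta>'"
    unfolding eventually_nhds_metric by (auto simp: dist_commute)
  define G where "G = (\<lambda>x. (H x w0 / K x w0) *s g x)"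
  \<comment> \<open>The last clause says that \<open>T\<close> is orthogonal to everything that is
    orthogonal to all images. If \<open>T\<close> itself is orthogonal to all images, this makes it
    null, as needed for \<open>rel_zero\<close>.\<close>
  define rel where "rel = (\<lambda>p T. (\<forall>w\<in>ball w0 \<delta>. hf c' T (g w) = \<gamma> w * H p w) \<and> (\<forall>j. c' j = 0 \<longrightarrow> T $ j = 0)
    \<and> (\<forall>X. (\<forall>w\<in>D. hf c' (g w) X = 0) \<longrightarrow> hf c' T X = 0))"
  have rel_G: "rel x (G x)" if x: "x \<in> ball xs \<rho>" for x
  proof -
    have xD: "x \<in> D" using \<rho>(2)[OF x] \<delta>(4) by blast
    have "hf c' (G x) (g w) = \<gamma> w * H x w" if "w \<in> ball w0 \<delta>" for w
      using \<gamma>(2)[OF that] \<rho>(2)[OF x] unfolding G_def hf_lin by (simp add: field_simps)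
    then show ?thesis unfolding rel_def using xD trunc by (auto simp: G_def hf_lin)
  qed
  have rel_add: "rel (p + q) (T + X)" if "rel p T" "rel q X" for p q T X
    using that unfolding rel_def by (auto simp: hf_lin algebra_simps)
  have rel_scale: "rel (k *s p) (k *s T)" if "rel p T" for k p T
    using that unfolding rel_def by (auto simp: hf_lin)
  have rel_sum: "rel (\<Sum>j\<in>I. p j) (\<Sum>j\<in>I. T j)" if "finite I" "\<And>j. rel (p j) (T j)" for I :: "'n set" and p T
    using that by (induction I rule: finite_induct) (auto intro: rel_add, auto simp: rel_def)
  have rel_zero: "T = 0" if T: "rel 0 T" for T
  proof (rule orthogonal_to_all_zero)
    have gT: "hf c' (g w) T = 0" if w: "w \<in> D" for w
    proof (rule line_hol_zero[OF line_hol_hf[OF holo open_D] open_D convex_D open_ball \<delta>(3) _ _ w])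
      show "ball w0 \<delta> \<noteq> {}" using \<delta> by simp
      fix w assume "w \<in> ball w0 \<delta>"
      then have "hf c' T (g w) = 0" using T unfolding rel_def by simp
      then show "hf c' (g w) T = 0" using hf_sym_0 by blast
    qed
    then show "hf c' T (g w) = 0" if "w \<in> D" for w using that hf_sym_0 by blast
    show "T $ j = 0" if "c' j = 0" for j using T that unfolding rel_def by blast
    show "hf c' T T = 0" using T gT unfolding rel_def by blast
  qed
  have "\<exists>T. rel p T" for p
  proof -
    define s where "s = complex_of_real (\<rho> / (2 * (norm p + 1)))"
    have np: "norm p + 1 > 0" using norm_ge_zero[of p] by linarith
    have s0: "s \<noteq> 0" unfolding s_def of_real_eq_0_iff using \<rho>(1) np by simp
    have "norm (s *s p) = \<rho> / (2 * (norm p + 1)) * norm p"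
      unfolding norm_vec_scale s_def norm_of_real using \<rho>(1) np by simp
    also have "\<dots> < \<rho>"
    proof -
      have "\<rho> * norm p < \<rho> * (2 * (norm p + 1))" by (rule mult_strict_left_mono) (use \<rho>(1) np in auto)
      then show ?thesis using np by (simp add: pos_divide_less_eq)
    qed
    finally have 1: "xs + s *s p \<in> ball xs \<rho>" by (simp add: dist_norm)
    have 2: "xs \<in> ball xs \<rho>" using \<rho>(1) by simp
    \<comment> \<open>An arbitrary \<open>p\<close> is a scaled difference of two points of the ball
      on which \<open>G\<close> is available.\<close>
    have "rel ((1 / s) *s ((xs + s *s p) + (-1) *s xs)) ((1 / s) *s (G (xs + s *s p) + (-1) *s G xs))"
      by (intro rel_scale rel_add rel_G 1 2)
    moreover have "(1 / s) *s ((xs + s *s p) + (-1) *s xs) = p" using s0 by (simp add: vec_eq_iff)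
    ultimately show ?thesis by auto
  qed
  then obtain L where L: "\<And>p. rel p (L p)" by metis
  define M where "M = (\<chi> k j. L (axis j 1) $ k)"
  have relM: "rel p (M *v p)" for p
  proof -
    have "rel (\<Sum>j\<in>UNIV. p $ j *s axis j 1) (\<Sum>j\<in>UNIV. p $ j *s L (axis j 1))"
      by (intro rel_sum rel_scale L) simp
    moreover have "(\<Sum>j\<in>UNIV. p $ j *s axis j 1) = p" by (rule basis_expansion)
    moreover have "(\<Sum>j\<in>UNIV. p $ j *s L (axis j 1)) = M *v p"
      by (simp add: vec_eq_iff M_def matrix_vector_mult_def sum_component mult.commute)
    ultimately show ?thesis by simp
  qed
  have MG: "M *v x = G x" if "x \<in> ball xs \<rho>" for x
  proof -
    have "rel (x + (-1) *s x) (M *v x + (-1) *s G x)" by (intro rel_add rel_scale relM rel_G that)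
    moreover have "x + (-1) *s x = 0" by (simp add: vec_eq_iff)
    ultimately have "M *v x + (-1) *s G x = 0" by (intro rel_zero) (simp only:)
    then show ?thesis by (simp add: vec_eq_iff)
  qed
  have \<rho>D: "ball xs \<rho> \<subseteq> D" using \<rho>(2) \<delta>(4) by blast
  have par: "g x $ i * (M *v x) $ j = g x $ j * (M *v x) $ i" if "x \<in> D" for x i j
  proof -
    have "g x $ i * (M *v x) $ j - g x $ j * (M *v x) $ i = 0"
    proof (rule line_hol_zero[OF _ open_D convex_D open_ball \<rho>D _ _ that])
      show "line_hol D (\<lambda>x. g x $ i * (M *v x) $ j - g x $ j * (M *v x) $ i)"
        by (intro line_hol_diff line_hol_mult line_hol_comp[OF holo open_D] line_hol_mv)
      show "ball xs \<rho> \<noteq> {}" using \<rho> by simp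
      show "g x $ i * (M *v x) $ j - g x $ j * (M *v x) $ i = 0" if "x \<in> ball xs \<rho>" for x
        unfolding MG[OF that] G_def by simp
    qed
    then show ?thesis by simp
  qed
  \<comment> \<open>\<open>M *v w\<close> is a multiple of the nonzero vector \<open>g w\<close>, so
    the defining relation of \<open>M\<close> becomes a proportionality of the pulled back form to
    \<open>H\<close>, with a factor that may still depend on \<open>w\<close>.\<close>
  have eig: "\<exists>k. \<forall>p. hf c' (M *v p) (M *v w) = k * H p w" if w: "w \<in> ball w0 \<delta>" for w
  proof -
    have r: "hf c' (M *v p) (g w) = \<gamma> w * H p w" for p using relM w unfolding rel_def by blast
    have wD: "w \<in> D" using w \<delta>(3) by blast
    have "H w (J w) \<noteq> 0" using nonrad[OF wD] by auto
    then have "H (J w) w \<noteq> 0" using hf_sym_0 by blast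
    then have "g w \<noteq> 0" using r[of "J w"] \<gamma>(1)[OF w] by auto
    then obtain k where "M *v w = k *s g w" using parallel_imp_scale[of "g w" "M *v w"] par[OF wD] by blast
    then have "hf c' (M *v p) (M *v w) = (cnj k * \<gamma> w) * H p w" for p using r[of p] by (simp add: hf_lin)
    then show ?thesis by blast
  qed
  define \<Psi> where "\<Psi> = (\<lambda>p q. hf c' (M *v p) (M *v q))"
  have \<Psi>_add: "\<Psi> p (q + q') = \<Psi> p q + \<Psi> p q'" for p q q' unfolding \<Psi>_def by (simp add: matrix_vector_right_distrib hf_lin)
  have \<Psi>_scale: "\<Psi> p (k *s q) = cnj k * \<Psi> p q" for p q k unfolding \<Psi>_def by (simp add: vector_scalar_commute hf_lin)
  obtain k0 where k0: "\<And>p. \<Psi> p w0 = k0 * H p w0" using eig[of w0] \<delta>(1) unfolding \<Psi>_def by auto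
  \<comment> \<open>The factors at \<open>w0\<close>, \<open>w0 + s v\<close> and
    \<open>w0 + (s/2) v\<close> are compared. Testing with \<open>x0\<close>, which is orthogonal to
    \<open>w0\<close> but not to \<open>v\<close>, identifies the last two; testing with
    \<open>u\<close>, which is not orthogonal to \<open>w0\<close>, identifies them with
    \<open>k0\<close>.\<close>
  have gen: "\<Psi> p v = k0 * H p v" if v: "H x0 v \<noteq> 0" for p v
  proof -
    define s where "s = complex_of_real (\<delta> / (2 * (norm v + 1)))"
    have nv: "norm v + 1 > 0" using norm_ge_zero[of v] by linarith
    have s0: "s \<noteq> 0" unfolding s_def of_real_eq_0_iff using \<delta>(1) nv by simp
    have "norm (s *s v) = \<delta> / (2 * (norm v + 1)) * norm v"
      unfolding norm_vec_scale s_def norm_of_real using \<delta>(1) nv by simp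
    also have "\<dots> < \<delta>"
    proof -
      have "\<delta> * norm v < \<delta> * (2 * (norm v + 1))" by (rule mult_strict_left_mono) (use \<delta>(1) nv in auto)
      then show ?thesis using nv by (simp add: pos_divide_less_eq)
    qed
    finally have sv: "norm (s *s v) < \<delta>" .
    have "norm ((s / 2) *s v) \<le> norm (s *s v)" unfolding norm_vec_scale norm_divide by (intro mult_right_mono) auto
    then have "w0 + s *s v \<in> ball w0 \<delta>" "w0 + (s / 2) *s v \<in> ball w0 \<delta>" using sv by (simp_all add: dist_norm)
    then obtain kb km where kb: "\<And>p. \<Psi> p (w0 + s *s v) = kb * H p (w0 + s *s v)"
      and km: "\<And>p. \<Psi> p (w0 + (s / 2) *s v) = km * H p (w0 + (s / 2) *s v)"
      using eig unfolding \<Psi>_def by metis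
    have b: "cnj s * \<Psi> p v = (kb - k0) * H p w0 + kb * cnj s * H p v" for p
      using kb[of p] k0[of p] by (simp add: \<Psi>_add \<Psi>_scale hf_lin algebra_simps)
    have m: "cnj s * \<Psi> p v = 2 * (km - k0) * H p w0 + km * cnj s * H p v" for p
    proof -
      have "k0 * H p w0 + cnj s / 2 * \<Psi> p v = km * (H p w0 + cnj s / 2 * H p v)"
        using km[of p] k0[of p] by (simp add: \<Psi>_add \<Psi>_scale hf_lin)
      then have "2 * (k0 * H p w0 + cnj s / 2 * \<Psi> p v) = 2 * (km * (H p w0 + cnj s / 2 * H p v))" by simp
      then show ?thesis by (simp add: algebra_simps)
    qed
    have "kb * cnj s * H x0 v = km * cnj s * H x0 v" using b[of x0] m[of x0] unfolding x0_w0 by algebra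
    then have "km = kb" using s0 v by simp
    then have "(kb - k0) * H u w0 = 0" using b[of u] m[of u] by auto
    then have "kb = k0" using u_w0 by simp
    then show ?thesis using b[of p] s0 by simp
  qed
  \<comment> \<open>A \<open>v\<close> orthogonal to \<open>x0\<close> is the difference of
    \<open>v + n1\<close> and \<open>n1\<close>, neither of which is.\<close>
  have all: "\<Psi> p v = k0 * H p v" for p v
  proof (cases "H x0 v = 0")
    case True
    then have "\<Psi> p (v + n1) = k0 * H p (v + n1)" "\<Psi> p n1 = k0 * H p n1"
      by (intro gen; simp add: hf_lin x0_n1)+
    then show ?thesis by (simp add: \<Psi>_add hf_lin algebra_simps)
  qed (rule gen)
  \<comment> \<open>A positive point \<open>x\<close> near the null point \<open>xs\<close>
    determines the factor: \<open>k0\<close> is the ratio of the squares of \<open>M *v x\<close>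
    and \<open>x\<close>, both positive.\<close>
  define s where "s = \<rho> / (2 * (norm (J xs) + 1))"
  have nJ: "norm (J xs) + 1 > 0" using norm_ge_zero[of "J xs"] by linarith
  have s: "s > 0" unfolding s_def using \<rho>(1) nJ by simp
  have "norm (of_real s *s J xs) = \<rho> / (2 * (norm (J xs) + 1)) * norm (J xs)"
    unfolding norm_vec_scale s_def norm_of_real using \<rho>(1) nJ by simp
  also have "\<dots> < \<rho>"
  proof -
    have "\<rho> * norm (J xs) < \<rho> * (2 * (norm (J xs) + 1))" by (rule mult_strict_left_mono) (use \<rho>(1) nJ in auto)
    then show ?thesis using nJ by (simp add: pos_divide_less_eq)
  qed
  finally have xp: "xs + of_real s *s J xs \<in> ball xs \<rho>" by (simp add: dist_norm)
  define x where "x = xs + of_real s *s J xs"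
  have x: "x \<in> ball xs \<rho>" "x \<in> D" using xp \<rho>D unfolding x_def by blast+
  define h where "h = Re (H x x)"
  have h: "h > 0" "H x x = of_real h" unfolding h_def x_def H_flip_line[OF xs(4)] using nonrad[OF xs(1)] s by simp_all
  define a where "a = H x w0 / K x w0"
  have a: "a \<noteq> 0" unfolding a_def using \<rho>(2)[OF x(1)] by simp
  define k where "k = (cmod a)\<^sup>2 * Re (K x x) / h"
  have kp: "k > 0" unfolding k_def using a h pos[OF x(2)] by simp
  have "k0 * of_real h = \<Psi> x x" unfolding all h(2) ..
  also have "\<dots> = (a * cnj a) * K x x" unfolding \<Psi>_def MG[OF x(1)] G_def hf_lin a_def by simp
  also have "\<dots> = of_real ((cmod a)\<^sup>2) * of_real (Re (K x x))"
    using complex_norm_square[of a] hf_self_Re[of c' "g x"] by simp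
  finally have k0k: "k0 = of_real k" unfolding k_def using h by (simp add: field_simps)
  define \<mu> where "\<mu> = complex_of_real (1 / sqrt k)"
  have \<mu>: "\<mu> * cnj \<mu> * k0 = 1" "\<mu> \<noteq> 0"
  proof -
    have "1 / sqrt k * (1 / sqrt k) * k = 1" using kp by simp
    then show "\<mu> * cnj \<mu> * k0 = 1" unfolding \<mu>_def k0k complex_cnj_complex_of_real of_real_mult[symmetric] by simp
    then show "\<mu> \<noteq> 0" by auto
  qed
  define M' where "M' = (\<chi> i j. \<mu> * M $ i $ j)"
  have M': "M' *v p = \<mu> *s (M *v p)" for p
    by (simp add: vec_eq_iff M'_def matrix_vector_mult_def sum_distrib_left mult.assoc)
  have "hf c' (M' *v p) (M' *v q) = H p q" for p q
  proof -
    have "hf c' (M' *v p) (M' *v q) = \<mu> * cnj \<mu> * \<Psi> p q" unfolding M' hf_lin \<Psi>_def by simp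
    also have "\<dots> = (\<mu> * cnj \<mu> * k0) * H p q" unfolding all by simp
    finally show ?thesis unfolding \<mu> by simp
  qed
  moreover have "(M' *v p) $ j = 0" if "c' j = 0" for p j using relM[of p] that unfolding M' rel_def by simp
  moreover have "g x $ i * (M' *v x) $ j = g x $ j * (M' *v x) $ i" if "x \<in> D" for x i j
    using par[OF that, of i j] unfolding M' by (simp add: algebra_simps)
  ultimately show ?thesis by blast
qed

end

lemma (in sign_map) exists_isometry_near:
  assumes "2 \<le> card {j. c j = 1}" "2 \<le> card {j. c j = -1}" "card {j. c' j = 1} \<le> card {j. c j = 1}"
    and z0: "z0 \<in> D" "H z0 z0 = 0"
  shows "\<exists>\<rho>>0. ball z0 \<rho> \<subseteq> D \<and> (\<exists>M::complex^'n^'m. (\<forall>p q. hf c' (M *v p) (M *v q) = H p q) \<and>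
     (\<forall>p j. c' j = 0 \<longrightarrow> (M *v p) $ j = 0) \<and>
     (\<forall>x\<in>ball z0 \<rho>. \<forall>i j. g x $ i * (M *v x) $ j = g x $ j * (M *v x) $ i))"
proof -
  obtain \<rho> where \<rho>: "\<rho> > 0" "ball z0 \<rho> \<subseteq> D" "\<And>z w. z \<in> ball z0 \<rho> \<Longrightarrow> w \<in> ball z0 \<rho> \<Longrightarrow> H z w = 0 \<Longrightarrow> K z w = 0"
    using K_orthogonal[OF z0] by blast
  interpret o: orth_map c c' g "ball z0 \<rho>"
  proof
    show "\<exists>z\<in>ball z0 \<rho>. H z z = 0" using z0(2) \<rho>(1) by (intro bexI[of _ z0]) auto
  qed (use sgn sgn' cholo_on_subset[OF holo \<rho>(2)] trunc pos neg nonrad \<rho> assms in auto)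
  obtain x u w n1 n2 where "x \<in> ball z0 \<rho> \<and> w \<in> ball z0 \<rho> \<and> H x x = 0 \<and> H u u = 0 \<and> H x u = 0 \<and> H x w = 0
     \<and> hf c' (o.dg x u) (g w) \<noteq> 0 \<and> (\<exists>w'\<in>ball z0 \<rho>. K x w' \<noteq> 0)
     \<and> H n1 n1 = 0 \<and> H n2 n2 = 0 \<and> H n1 n2 = 0 \<and> H x n1 = 1 \<and> H u n1 = 0 \<and> H x n2 = 0 \<and> H u n2 = 1"
    using o.exists_simple_pair by (elim exE) (rule that)
  then interpret s: simple_pair c c' g "ball z0 \<rho>" x u w n1 n2
    by unfold_locales blast+
  show ?thesis using s.exists_isometry \<rho>(1,2) by blast
qed

subsection \<open>Continuation and conclusion\<close>

definition support_proj :: "('m::finite \<Rightarrow> real) \<Rightarrow> complex^'m \<Rightarrow> complex^'m" where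
  "support_proj c v = (\<chi> j. if c j = 0 then 0 else v $ j)"

lemma hf_support_proj: "hf c (support_proj c v) (support_proj c w) = hf c v w"
  unfolding hf_def support_proj_def by (intro sum.cong) auto

lemma support_proj_scale: "support_proj c (k *s v) = k *s support_proj c v"
  by (simp add: support_proj_def vec_eq_iff)

lemma cholo_on_support_proj:
  assumes "cholo_on S g"
  shows "cholo_on S (\<lambda>x. support_proj c (g x))"
  unfolding cholo_on_def
proof
  fix z assume "z \<in> S"
  then obtain g' where g': "(g has_derivative g') (at z)" "\<And>k v. g' (k *s v) = k *s g' v"
    using assms unfolding cholo_on_def by blast
  have "linear (support_proj c :: complex^'b \<Rightarrow> complex^'b)"
    by (rule linearI) (simp_all add: support_proj_def vec_eq_iff)
  then have "bounded_linear (support_proj c :: complex^'b \<Rightarrow> complex^'b)" by (rule linear_conv_bounded_linear[THEN iffD1])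
  from bounded_linear.has_derivative[OF this g'(1)]
  show "\<exists>g'. ((\<lambda>x. support_proj c (g x)) has_derivative g') (at z) \<and> (\<forall>k v. g' (k *s v) = k *s g' v)"
    using g'(2) by (intro exI[of _ "\<lambda>h. support_proj c (g' h)"]) (simp add: support_proj_scale)
qed

lemma parallel_scale_iff:
  fixes a b :: "complex^'m"
  assumes "k \<noteq> 0"
  shows "(\<forall>i j. (k *s a) $ i * b $ j = (k *s a) $ j * b $ i) \<longleftrightarrow> (\<forall>i j. a $ i * b $ j = a $ j * b $ i)"
  using assms by (simp add: mult.assoc)

text \<open>The given null point may lie in the radical, where the local argument does not apply; a
  small step along a null vector orthogonal to it leads to a null point outside. From there
  parallelism with \<open>M\<close> spreads over \<open>V\<close> by connectedness.\<close>

lemma exists_global_isometry: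
  fixes c :: "'n::finite \<Rightarrow> real" and c' :: "'m::finite \<Rightarrow> real" and f :: "complex^'n \<Rightarrow> complex^'m"
  assumes sgn: "\<And>j. c j \<in> {-1, 0, 1}" and sgn': "\<And>j. c' j \<in> {-1, 0, 1}"
    and ind: "2 \<le> card {j. c j = 1}" "2 \<le> card {j. c j = -1}" "card {j. c' j = 1} \<le> card {j. c j = 1}"
    and V: "open V" "connected V" and z0: "z0 \<in> V" "hf c z0 z0 = 0" and f: "proj_holo_map V f"
    and pos_V: "\<And>x. x \<in> V \<Longrightarrow> Re (hf c x x) > 0 \<Longrightarrow> Re (hf c' (f x) (f x)) > 0"
    and neg_V: "\<And>x. x \<in> V \<Longrightarrow> Re (hf c x x) < 0 \<Longrightarrow> Re (hf c' (f x) (f x)) < 0"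
  shows "\<exists>M::complex^'n^'m. (\<forall>p q. hf c' (M *v p) (M *v q) = hf c p q) \<and> (\<forall>p j. c' j = 0 \<longrightarrow> (M *v p) $ j = 0) \<and>
     (\<exists>x\<in>V. hf c' (f x) (f x) \<noteq> 0 \<and> hf c x x \<noteq> 0) \<and>
     (\<forall>x\<in>V. \<forall>i j. support_proj c' (f x) $ i * (M *v x) $ j = support_proj c' (f x) $ j * (M *v x) $ i)"
proof -
  obtain u where u: "hf c u u = 0" "hf c u z0 = 0" "hf c (hflip c u) z0 = 0" "hf c u (hflip c u) = 1"
    using exists_null_companion[OF sgn ind(1,2), of z0] by blast
  have u': "hf c z0 u = 0" "hf c z0 (hflip c u) = 0" "hf c u (hflip c z0) = 0"
    using u hf_sym_0 hflip_commute by metis+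
  have "((\<lambda>e::real. z0 + of_real e *s u) \<longlongrightarrow> z0 + of_real 0 *s u) (at_right 0)" by (intro tendsto_intros)
  then have "eventually (\<lambda>e::real. z0 + of_real e *s u \<in> V) (at_right 0)"
    using topological_tendstoD[OF _ V(1)] z0(1) by force
  then have "eventually (\<lambda>e::real. z0 + of_real e *s u \<in> V \<and> e > 0) (at_right 0)"
    by (rule eventually_conj) (simp add: eventually_at_filter)
  then obtain e :: real where e: "z0 + of_real e *s u \<in> V" "e > 0"
    using eventually_happens'[OF trivial_limit_at_right_real] by (metis (no_types, lifting))
  define z1 where "z1 = z0 + of_real e *s u"
  have z1V: "z1 \<in> V" using e unfolding z1_def by blast
  have z1: "hf c z1 z1 = 0" unfolding z1_def hf_lin u u' z0 by simp
  have "hflip c z1 = hflip c z0 + of_real e *s hflip c u" unfolding z1_def hflip_def by (simp add: vec_eq_iff algebra_simps)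
  then have "hf c z1 (hflip c z1) = hf c z0 (hflip c z0) + of_real (e * e)"
    unfolding z1_def by (simp add: hf_lin u u')
  moreover have "Re (hf c z0 (hflip c z0)) \<ge> 0" unfolding hf_hflip_self Re_complex_of_real by (rule sum_nonneg) simp
  ultimately have z1r: "Re (hf c z1 (hflip c z1)) > 0" using e(2) by (simp add: add_nonneg_pos)
  have lift: "\<exists>e>0. \<exists>g. ball z e \<subseteq> V \<and> cholo_on (ball z e) g \<and> (\<forall>w\<in>ball z e. \<exists>k. k \<noteq> 0 \<and> g w = k *s f w)" if "z \<in> V" for z
  proof -
    have "\<exists>e>0. \<exists>g. ball z e \<subseteq> V \<and> cholo_on (ball z e) g \<and> (\<forall>w\<in>ball z e. proj_eq (f w) (g w))"
      using f that unfolding proj_holo_map_def by (elim conjE) (erule bspec)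
    then show ?thesis unfolding proj_eq_def by blast
  qed
  obtain e1 g1 where e1: "e1 > 0" "ball z1 e1 \<subseteq> V" "cholo_on (ball z1 e1) g1"
    and g1: "\<And>w. w \<in> ball z1 e1 \<Longrightarrow> \<exists>k. k \<noteq> 0 \<and> g1 w = k *s f w"
    using lift[OF z1V] by blast
  have "continuous_on UNIV (hflip c)" unfolding hflip_def by (intro continuous_intros)
  then have "open {x. Re (hf c x (hflip c x)) > 0}"
    by (intro open_Collect_less continuous_intros)
  then have "eventually (\<lambda>x. Re (hf c x (hflip c x)) > 0) (nhds z1)" using eventually_nhds_in_open z1r by force
  then obtain e2 where e2: "e2 > 0" "\<And>x. dist x z1 < e2 \<Longrightarrow> Re (hf c x (hflip c x)) > 0" unfolding eventually_nhds_metric by blast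
  define D where "D = ball z1 (min e1 e2)"
  have DV: "D \<subseteq> V" "D \<subseteq> ball z1 e1" using e1 unfolding D_def by auto
  define g where "g = (\<lambda>x. support_proj c' (g1 x))"
  have gf: "\<exists>k>0. hf c' (g x) (g x) = of_real k * hf c' (f x) (f x)" if x: "x \<in> D" for x
  proof -
    obtain k where "k \<noteq> 0" "g1 x = k *s f x" using g1 x DV(2) by blast
    then show ?thesis unfolding g_def hf_support_proj
      by (intro exI[of _ "(cmod k)\<^sup>2"]) (simp add: hf_lin complex_norm_square del: of_real_power)
  qed
  interpret sign_map c c' g D
  proof
    show "cholo_on D g" unfolding g_def by (intro cholo_on_support_proj cholo_on_subset[OF e1(3) DV(2)])
    show "open D" "convex D" unfolding D_def by auto
    show "g x $ j = 0" if "x \<in> D" "c' j = 0" for x j using that unfolding g_def support_proj_def by simp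
    show "Re (hf c' (g x) (g x)) > 0" if x: "x \<in> D" "Re (hf c x x) > 0" for x
      using gf[OF x(1)] pos_V x DV by auto
    show "Re (hf c' (g x) (g x)) < 0" if x: "x \<in> D" "Re (hf c x x) < 0" for x
      using gf[OF x(1)] neg_V x DV by (auto simp: mult_less_0_iff)
    show "Re (hf c x (hflip c x)) > 0" if "x \<in> D" for x using e2(2) that unfolding D_def by (auto simp: dist_commute)
  qed (use sgn sgn' in auto)
  have z1D: "z1 \<in> D" using e1 e2 unfolding D_def by simp
  obtain \<rho> M where \<rho>: "\<rho> > 0" "ball z1 \<rho> \<subseteq> D" and M: "\<forall>p q. hf c' (M *v p) (M *v q) = hf c p q"
     "\<forall>p j. c' j = 0 \<longrightarrow> (M *v p) $ j = 0"
     "\<forall>x\<in>ball z1 \<rho>. \<forall>i j. g x $ i * (M *v x) $ j = g x $ j * (M *v x) $ i"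
    using exists_isometry_near[OF ind z1D z1] by blast
  \<comment> \<open>\<open>f\<close> itself need not be holomorphic, only its local lifts are.
    Parallelism is unchanged by nonzero scaling and can therefore be tested on any lift.\<close>
  define P where "P = (\<lambda>x. \<forall>i j. support_proj c' (f x) $ i * (M *v x) $ j = support_proj c' (f x) $ j * (M *v x) $ i)"
  have P_lift: "P w \<longleftrightarrow> (\<forall>i j. support_proj c' (h w) $ i * (M *v w) $ j = support_proj c' (h w) $ j * (M *v w) $ i)"
    if "k \<noteq> 0" "h w = k *s f w" for h w k
    unfolding P_def that(2) support_proj_scale using parallel_scale_iff[OF that(1)] by blast
  have P1: "P w" if w: "w \<in> ball z1 \<rho>" for w
  proof -
    obtain k where "k \<noteq> 0" "g1 w = k *s f w" using g1 w \<rho> DV(2) by blast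
    from P_lift[of k g1 w, OF this] show ?thesis using M(3) w unfolding g_def by blast
  qed
  have cont: "P x" if z: "ball z r \<subseteq> V" "cholo_on (ball z r) h" "\<forall>w\<in>ball z r. \<exists>k. k \<noteq> 0 \<and> h w = k *s f w"
    and U: "open U" "U \<noteq> {}" "U \<subseteq> ball z r" "\<And>w. w \<in> U \<Longrightarrow> P w" and x: "x \<in> ball z r" for z r h U x
  proof -
    define hh where "hh = (\<lambda>w. support_proj c' (h w))"
    have hh: "P w \<longleftrightarrow> (\<forall>i j. hh w $ i * (M *v w) $ j = hh w $ j * (M *v w) $ i)" if w: "w \<in> ball z r" for w
      using z(3) w P_lift[of _ h w] unfolding hh_def by blast
    have hol: "cholo_on (ball z r) hh" unfolding hh_def by (rule cholo_on_support_proj[OF z(2)])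
    have "hh x $ i * (M *v x) $ j - hh x $ j * (M *v x) $ i = 0" for i j
    proof (rule line_hol_zero[OF _ open_ball convex_ball U(1,3,2) _ x])
      show "line_hol (ball z r) (\<lambda>x. hh x $ i * (M *v x) $ j - hh x $ j * (M *v x) $ i)"
        by (intro line_hol_diff line_hol_mult line_hol_comp[OF hol open_ball] line_hol_mv)
      fix w assume w: "w \<in> U"
      then have "P w" "w \<in> ball z r" using U by auto
      then show "hh w $ i * (M *v w) $ j - hh w $ j * (M *v w) $ i = 0" using hh by simp
    qed
    then show ?thesis unfolding hh[OF x] by simp
  qed
  \<comment> \<open>\<open>W\<close> collects the points around which \<open>P\<close> holds,
    \<open>W'\<close> those with a neighbourhood free of \<open>W\<close>. On a ball with a
    holomorphic lift, \<open>P\<close> on a nonempty open part gives \<open>P\<close> throughout, so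
    the two open sets cover \<open>V\<close>.\<close>
  define W where "W = {x. \<exists>U. open U \<and> x \<in> U \<and> U \<subseteq> V \<and> (\<forall>w\<in>U. P w)}"
  define W' where "W' = {x. \<exists>U. open U \<and> x \<in> U \<and> U \<subseteq> V \<and> U \<inter> W = {}}"
  have oW: "open W" unfolding open_subopen[of W] by (auto simp: W_def)
  have oW': "open W'" unfolding open_subopen[of W'] by (auto simp: W'_def)
  have cover: "V \<subseteq> W \<union> W'"
  proof
    fix z assume "z \<in> V"
    then obtain r h where rh: "r > 0" "ball z r \<subseteq> V" "cholo_on (ball z r) h" "\<forall>w\<in>ball z r. \<exists>k. k \<noteq> 0 \<and> h w = k *s f w"
      using lift by blast
    show "z \<in> W \<union> W'"
    proof (cases "ball z r \<inter> W = {}")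
      case True then show ?thesis using rh unfolding W'_def by (auto intro!: exI[of _ "ball z r"])
    next
      case False
      then obtain y U where y: "y \<in> ball z r" "open U" "y \<in> U" "\<forall>w\<in>U. P w" unfolding W_def by blast
      have "P x" if "x \<in> ball z r" for x
        by (rule cont[OF rh(2-4), of "U \<inter> ball z r"]) (use y that in auto)
      then show ?thesis using rh unfolding W_def by (auto intro!: exI[of _ "ball z r"])
    qed
  qed
  have "W \<inter> W' = {}" unfolding W'_def by blast
  then have "W \<inter> V = {} \<or> W' \<inter> V = {}" by (intro connectedD[OF V(2) oW oW' _ cover]) auto
  moreover have "z1 \<in> W" unfolding W_def using P1 \<rho> DV by (auto intro!: exI[of _ "ball z1 \<rho>"])
  ultimately have "V \<subseteq> W" using z1V cover by blast
  then have PV: "P x" if "x \<in> V" for x using that unfolding W_def by blast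
  \<comment> \<open>At such a point neither \<open>M *v x\<close> nor the nonnull part of
    \<open>f x\<close> is zero; without it parallelism could hold trivially.\<close>
  have "\<exists>x\<in>V. hf c' (f x) (f x) \<noteq> 0 \<and> hf c x x \<noteq> 0"
  proof -
    have "((\<lambda>e::real. z1 + of_real e *s hflip c z1) \<longlongrightarrow> z1 + of_real 0 *s hflip c z1) (at_right 0)" by (intro tendsto_intros)
    then have "eventually (\<lambda>e::real. z1 + of_real e *s hflip c z1 \<in> V) (at_right 0)"
      using topological_tendstoD[OF _ V(1)] z1V by force
    then have "eventually (\<lambda>e::real. z1 + of_real e *s hflip c z1 \<in> V \<and> e > 0) (at_right 0)"
      by (rule eventually_conj) (simp add: eventually_at_filter)
    then obtain e :: real where e: "z1 + of_real e *s hflip c z1 \<in> V" "e > 0"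
      using eventually_happens'[OF trivial_limit_at_right_real] by (metis (no_types, lifting))
    have "Re (hf c (z1 + of_real e *s hflip c z1) (z1 + of_real e *s hflip c z1)) > 0"
      unfolding H_flip_line[OF z1] using e z1r by simp
    then show ?thesis using pos_V[OF e(1)] e(1) by (intro bexI[of _ "z1 + of_real e *s hflip c z1"]) auto
  qed
  then show ?thesis using M(1,2) PV unfolding P_def by blast
qed

section \<open>Signatures, complementary projections and the theorem\<close>

lemma bij_idx: "bij_betw (idx :: 'n::finite \<Rightarrow> nat) UNIV {..<CARD('n)}"
proof -
  have "\<exists>h. bij_betw h (UNIV :: 'n set) {..<CARD('n)}"
    using ex_bij_betw_finite_nat[of "UNIV :: 'n set"] by (simp add: atLeast0LessThan)
  then show ?thesis unfolding idx_def by (rule someI_ex)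
qed

lemma card_idx_vimage:
  assumes "S \<subseteq> {..<CARD('n::finite)}"
  shows "card {j::'n. idx j \<in> S} = card S"
proof -
  have "inj_on (idx :: 'n \<Rightarrow> nat) {j. idx j \<in> S}" using bij_idx[where 'n = 'n] inj_on_subset unfolding bij_betw_def by blast
  moreover have "idx ` {j::'n. idx j \<in> S} = S"
  proof -
    have "S \<subseteq> range (idx :: 'n \<Rightarrow> nat)" using assms bij_idx[where 'n = 'n] unfolding bij_betw_def by blast
    then show ?thesis by auto
  qed
  ultimately show ?thesis using card_image by metis
qed

definition rsgn :: "nat \<Rightarrow> nat \<Rightarrow> 'n::finite \<Rightarrow> real" where
  "rsgn r s j = (if idx j < r then 1 else if idx j < r + s then -1 else 0)"

lemma herm_eq_hf: "herm r s = hf (rsgn r s)"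
  by (intro ext) (auto simp: herm_def hf_def sgn_coef_def rsgn_def intro!: sum.cong)

lemma card_rsgn:
  assumes "r + s \<le> CARD('n::finite)"
  shows "card {j::'n. rsgn r s j = 1} = r" "card {j::'n. rsgn r s j = -1} = s"
proof -
  have 1: "{j::'n. rsgn r s j = 1} = {j. idx j \<in> {..<r}}" and 2: "{j::'n. rsgn r s j = -1} = {j. idx j \<in> {r..<r + s}}"
    unfolding rsgn_def by auto
  show "card {j::'n. rsgn r s j = 1} = r" unfolding 1 by (subst card_idx_vimage) (use assms in auto)
  show "card {j::'n. rsgn r s j = -1} = s" unfolding 2 by (subst card_idx_vimage) (use assms in auto)
qed

lemma proj_along_eqI:
  assumes "csubspace A" "csubspace B" "A \<inter> B = {0}" "a \<in> A" "x - a \<in> B"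
  shows "proj_along A B x = a"
  unfolding proj_along_def
proof (rule the_equality)
  show "a \<in> A \<and> x - a \<in> B" using assms by blast
  fix a' assume a': "a' \<in> A \<and> x - a' \<in> B"
  have neg: "- v \<in> S" if "csubspace S" "v \<in> S" for S :: "(complex^'a) set" and v
  proof -
    have "(-1) *s v \<in> S" using that unfolding csubspace_def by blast
    moreover have "(-1) *s v = - v" by (simp add: vec_eq_iff)
    ultimately show ?thesis by simp
  qed
  have "a' + - a \<in> A" using a' assms neg unfolding csubspace_def by blast
  moreover have "(x - a) + - (x - a') \<in> B" using a' assms neg unfolding csubspace_def by blast
  ultimately have "a' - a \<in> A \<inter> B" by simp
  then show "a' = a" using assms(3) by simp
qed

lemma csubspace_support: "csubspace {v. \<forall>j. Q j \<longrightarrow> v $ j = 0}"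
  unfolding csubspace_def by simp

theorem mainTheorem10:
  fixes r s t r' s' t' :: nat
    and V :: "(complex^'n::finite) set"
    and f :: "complex^'n \<Rightarrow> complex^'m::finite"
  assumes "CARD('n) = r + s + t" and "CARD('m) = r' + s' + t'"
    and "r \<ge> 2" and "s \<ge> 2"
    and "open V" and "connected V" and "cone_set V"
    and "\<exists>z\<in>V. null_pt r s z"
    and "proj_holo_map V f"
    and "sign_preserving r s r' s' V f"
    and "r = r' \<or> s = s'"
  shows "quasi_standard r s r' s' V f \<and> (t' = 0 \<longrightarrow> standard_map r s r' s' V f)"
proof -
  define c :: "'n \<Rightarrow> real" where "c = rsgn r s"
  define c' :: "'m \<Rightarrow> real" where "c' = rsgn r' s'"
  have card_c: "card {j. c j = 1} = r" "card {j. c j = -1} = s" "card {j. c' j = 1} = r'" "card {j. c' j = -1} = s'"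
    unfolding c_def c'_def using assms(1,2) card_rsgn by (simp_all add: card_rsgn)
  have sgn: "c j \<in> {-1, 0, 1}" "c' i \<in> {-1, 0, 1}" for i j unfolding c_def c'_def rsgn_def by auto
  obtain z0 where z0: "z0 \<in> V" "hf c z0 z0 = 0" using assms(8) unfolding null_pt_def herm_eq_hf c_def by blast
  have nonzero: "x \<noteq> 0" if "x \<in> V" for x using assms(7) that unfolding cone_set_def by blast
  have pos: "Re (hf c' (f x) (f x)) > 0" if "x \<in> V" "Re (hf c x x) > 0" for x
    using assms(10) nonzero[OF that(1)] that unfolding sign_preserving_def pos_pt_def herm_eq_hf c_def c'_def by blast
  have neg: "Re (hf c' (f x) (f x)) < 0" if "x \<in> V" "Re (hf c x x) < 0" for x
    using assms(10) nonzero[OF that(1)] that unfolding sign_preserving_def neg_pt_def herm_eq_hf c_def c'_def by blast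
  have "\<exists>M::complex^'n^'m. (\<forall>p q. hf c' (M *v p) (M *v q) = hf c p q) \<and> (\<forall>p j. c' j = 0 \<longrightarrow> (M *v p) $ j = 0) \<and>
     (\<exists>x\<in>V. hf c' (f x) (f x) \<noteq> 0 \<and> hf c x x \<noteq> 0) \<and>
     (\<forall>x\<in>V. \<forall>i j. support_proj c' (f x) $ i * (M *v x) $ j = support_proj c' (f x) $ j * (M *v x) $ i)"
    using assms(11)
  proof
    assume "r = r'"
    then show ?thesis
      by (intro exists_global_isometry[OF _ _ _ _ _ assms(5,6) z0 assms(9)] sgn pos neg) (use assms(3,4) card_c in simp_all)
  next
    \<comment> \<open>The weights \<open>-c\<close> and \<open>-c'\<close> interchange positive and
      negative points and keep the null coordinates, and an isometry for the negated forms is one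
      for the original forms.\<close>
    assume "s = s'"
    have "card {j. - c j = 1} = s" "card {j. - c j = - 1} = r" "card {j. - c' j = 1} = s'"
      using card_c by (simp_all add: minus_equation_iff[of _ 1] eq_commute[of "- 1"])
    moreover have "support_proj (\<lambda>j. - c' j) = support_proj c'" by (simp add: support_proj_def fun_eq_iff)
    moreover have "- c j \<in> {-1, 0, 1}" "- c' i \<in> {-1, 0, 1}" for i j using sgn(1)[of j] sgn(2)[of i] by auto
    ultimately show ?thesis
      using exists_global_isometry[of "\<lambda>j. - c j" "\<lambda>j. - c' j", OF _ _ _ _ _ assms(5,6) z0(1) _ assms(9)]
        \<open>s = s'\<close> assms(3,4) pos neg z0(2) by (simp add: hf_uminus)
  qed
  then obtain M :: "complex^'n^'m" and x where M: "\<And>p q. hf c' (M *v p) (M *v q) = hf c p q" "\<And>p j. c' j = 0 \<Longrightarrow> (M *v p) $ j = 0"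
    and x: "x \<in> V" "hf c' (f x) (f x) \<noteq> 0" "hf c x x \<noteq> 0"
    and par: "\<And>x i j. x \<in> V \<Longrightarrow> support_proj c' (f x) $ i * (M *v x) $ j = support_proj c' (f x) $ j * (M *v x) $ i"
    by blast
  have Mx: "M *v x \<noteq> 0" using M(1)[of x x] x(3) by auto
  have fx: "support_proj c' (f x) \<noteq> 0" using x(2) hf_support_proj[of c' "f x" "f x"] by auto
  have iso: "lin_isometry r s r' s' M" unfolding lin_isometry_def herm_eq_hf using M(1) unfolding c_def c'_def by blast
  have ind: "induced_by V (\<lambda>z. support_proj c' (f z)) (\<lambda>z. M *v z)"
    unfolding induced_by_def
  proof (intro conjI ballI impI)
    show "\<exists>z\<in>V. M *v z \<noteq> 0 \<and> support_proj c' (f z) \<noteq> 0" using x(1) Mx fx by blast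
    fix z assume z: "z \<in> V" "M *v z \<noteq> 0 \<and> support_proj c' (f z) \<noteq> 0"
    then obtain k where "M *v z = k *s support_proj c' (f z)" using parallel_imp_scale par by blast
    then show "proj_eq (support_proj c' (f z)) (M *v z)" using z(2) unfolding proj_eq_def by auto
  qed
  have nd: "standard_map r s r' s' V f" if "\<And>j. c' j \<noteq> 0"
  proof -
    have "support_proj c' (f z) = f z" for z using that by (simp add: support_proj_def vec_eq_iff)
    then show ?thesis unfolding standard_map_def using iso ind by auto
  qed
  show ?thesis
  proof (cases "\<exists>j. c' j = 0")
    case False
    then show ?thesis using nd unfolding quasi_standard_def by blast
  next
    case True
    then obtain j0 where j0: "c' j0 = 0" by blast
    have "idx j0 < r' + s' + t'" using bij_idx[where 'n = 'm] assms(2) unfolding bij_betw_def by auto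
    \<comment> \<open>A null coordinate excludes \<open>t' = 0\<close>, so only quasi-standardness
      remains to be shown.\<close>
    then have t': "t' \<noteq> 0" using j0 unfolding c'_def rsgn_def by (auto split: if_splits)
    define A where "A = {v::complex^'m. \<forall>j. c' j = 0 \<longrightarrow> v $ j = 0}"
    define B where "B = {v::complex^'m. \<forall>j. c' j \<noteq> 0 \<longrightarrow> v $ j = 0}"
    have sub: "csubspace A" "csubspace B" unfolding A_def B_def by (rule csubspace_support)+
    have AB: "A \<inter> B = {0}" unfolding A_def B_def by (auto simp: vec_eq_iff) metis
    have pA: "support_proj c' v \<in> A" "v - support_proj c' v \<in> B" for v unfolding A_def B_def support_proj_def by auto
    have projA: "proj_along A B v = support_proj c' v" for v by (rule proj_along_eqI[OF sub AB pA])
    have projB: "proj_along B A v \<in> B" for v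
      using proj_along_eqI[OF sub(2,1) _ pA(2)[of v], of v] AB pA[of v] by (simp add: Int_commute)
    \<comment> \<open>\<open>B\<close> is orthogonal to the whole space, so it can itself serve as
      the null subspace containing the second component.\<close>
    have null: "hf c' a b = 0" if "b \<in> B" for a b
      unfolding hf_def by (rule sum.neutral) (use that in \<open>auto simp: B_def\<close>)
    have "M *v x \<in> A" using M(2) unfolding A_def by blast
    then have A0: "A \<noteq> {0}" using Mx by blast
    have "axis j0 1 \<in> B" "axis j0 1 \<noteq> (0 :: complex^'m)" unfolding B_def using j0 by (auto simp: axis_def vec_eq_iff)
    then have B0: "B \<noteq> {0}" by blast
    have "quasi_standard r s r' s' V f"
      unfolding quasi_standard_def
    proof (rule disjI2, rule exI[of _ A], rule exI[of _ B], intro conjI)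
      show "\<forall>x. \<exists>a\<in>A. \<exists>b\<in>B. x = a + b"
      proof
        fix v show "\<exists>a\<in>A. \<exists>b\<in>B. v = a + b"
          by (intro bexI[of _ "support_proj c' v"] bexI[of _ "v - support_proj c' v"] pA) simp
      qed
      show "\<forall>a\<in>A. \<forall>b\<in>B. herm r' s' a b = 0" unfolding herm_eq_hf using null unfolding c'_def by blast
      show "\<exists>M::complex^'n^'m. lin_isometry r s r' s' M \<and> (\<forall>u. M *v u \<in> A) \<and> induced_by V (\<lambda>z. proj_along A B (f z)) ((*v) M)"
        unfolding projA using iso ind M(2) by (intro exI[of _ M]) (simp add: A_def)
      show "\<exists>H. csubspace H \<and> H \<subseteq> B \<and> (\<forall>x\<in>H. \<forall>y\<in>H. herm r' s' x y = 0) \<and>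
           (\<forall>z\<in>V. proj_along B A (f z) \<noteq> 0 \<longrightarrow> proj_along B A (f z) \<in> H)"
        unfolding herm_eq_hf using sub(2) null projB unfolding c'_def by (intro exI[of _ B]) blast
    qed (use sub AB A0 B0 in blast)+
    then show ?thesis using t' by blast
  qed
qed

end
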